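(* Let $(X,|\cdot|_X)$ be a Banach space and let $\tau$ be a Hausdorff locally convex topology on $X$ satisfying conditions (a), (b), (c) of the context. Let $T=\{T_t\}_{t\in\mathbb{R}^+}$ be a bi-continuous semigroup on $X$ with respect to $\tau$ and of type $\alpha\in\mathbb{R}$. Then there exists a locally convex topology $\tau'$ on $X$ with the following properties: (i) $\tau\subset\tau'$ and $\tau'$ is weaker than the $|\cdot|_X$-topology; (ii) a sequence converges in $\tau'$ if and only if it is $|\cdot|_X$-bounded and convergent in $\tau$; (iii) $(X,\tau')$ is sequentially complete; (iv) $T$ is a $C_0$-sequentially locally equicontinuous semigroup on $(X,\tau')$; moreover, for every $\lambda>\alpha$, $\{e^{-\lambda t}T_t\}_{t\in\mathbb{R}^+}$ is a $C_0$-sequentially equicontinuous semigroup on $(X,\tau')$ such that, for every $x\in X$ and $\mu>0$, the generalized Riemann integral $\int_0^{+\infty}e^{-\mu t}e^{-\lambda t}T_tx\,dt$ exists in $(X,\tau')$.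
   Context: $\mathbb{R}^+=[0,+\infty)$. Let $X^*$ be the dual of $(X,|\cdot|_X)$. A linear subspace $\Gamma\subset X^*$ is norming for $(X,|\cdot|_X)$ if $|x|_X=\sup_{\gamma\in\Gamma,\,|\gamma|_{X^*}\le1}|\gamma(x)|$ for every $x\in X$. Conditions on $\tau$: (a) $(X,\tau)$ is sequentially complete on $|\cdot|_X$-bounded sets, i.e. every $|\cdot|_X$-bounded $\tau$-Cauchy sequence converges in $(X,\tau)$; (b) $\tau$ is weaker (coarser) than the topology induced by $|\cdot|_X$; (c) the topological dual of $(X,\tau)$ is norming for $(X,|\cdot|_X)$. A family $T=\{T_t\}_{t\in\mathbb{R}^+}$ of bounded linear operators on $(X,|\cdot|_X)$ is a bi-continuous semigroup with respect to $\tau$ and of type $\alpha\in\mathbb{R}$ if: $T_0=I$ and $T_tT_s=T_{t+s}$ for all $t,s\in\mathbb{R}^+$; for some $M\ge0$, $|T_t|_{L((X,|\cdot|_X))}\le Me^{\alpha t}$ for every $t\in\mathbb{R}^+$; the map $\mathbb{R}^+\to(X,\tau)$, $t\mapsto T_tx$, is continuous for every $x\in X$; and for every $|\cdot|_X$-bounded sequence $\{x_n\}_{n\in\mathbb{N}}$ that is $\tau$-convergent to $x\in X$ and every $\hat t>0$, $\lim_{n\to+\infty}T_tx_n=T_tx$ in $(X,\tau)$, uniformly in $t\in[0,\hat t]$. A family $\{f_\iota\}_{\iota\in\mathcal{I}}$ of maps from a topological vector space $Z$ to itself is sequentially equicontinuous if for every $z_n\to z$ in $Z$ and every neighborhood $U$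 of $0$ there is $\overline n$ with $f_\iota(z_n)\in f_\iota(z)+U$ for all $\iota\in\mathcal{I}$, $n\ge\overline n$. A family of linear operators $\{T_t\}_{t\in\mathbb{R}^+}$ on a Hausdorff locally convex space $Z$ is a $C_0$-sequentially equicontinuous (resp. $C_0$-sequentially locally equicontinuous) semigroup if $T_0=I$, $T_{t+s}=T_tT_s$, $\lim_{t\to0^+}T_tz=z$ for all $z\in Z$, and $\{T_t\}_{t\in\mathbb{R}^+}$ is sequentially equicontinuous (resp. $\{T_t\}_{t\in[0,R]}$ is sequentially equicontinuous for every $R>0$). The generalized Riemann integral over $[0,+\infty)$ exists if the Riemann integrals over $[0,a]$ exist for all $a\ge0$ and converge as $a\to+\infty$. *)

theory Defs
  imports "HOL-Analysis.Analysis"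
begin

text \<open>
  A Banach space carries several topologies here, so every topology other than the norm topology
  is an explicit value of type \<^typ>\<open>'a topology\<close>; the norm topology is
  \<^term>\<open>euclidean :: 'a::real_normed_vector topology\<close>. Scalars are real.
  Families indexed by the half line are functions on \<^typ>\<open>real\<close>, constrained only at \<open>t \<ge> 0\<close>.
\<close>

section \<open>Locally convex topologies\<close>

definition coarser_topology :: "'a topology \<Rightarrow> 'a topology \<Rightarrow> bool" where
  "coarser_topology S T \<longleftrightarrow> (\<forall>U. openin S U \<longrightarrow> openin T U)"

definition locally_convex_topology :: "'a::real_vector topology \<Rightarrow> bool" where
  "locally_convex_topology Z \<longleftrightarrow>
     topspace Z = UNIV \<and>
     continuous_map (prod_topology Z Z) Z (\<lambda>(x, y). x + y) \<and>
     continuous_map (prod_topology euclideanreal Z) Z (\<lambda>(c, x). c *\<^sub>R x) \<and>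
     (\<forall>U. openin Z U \<and> 0 \<in> U \<longrightarrow>
        (\<exists>C V. convex C \<and> C \<subseteq> U \<and> openin Z V \<and> 0 \<in> V \<and> V \<subseteq> C))"

definition convergent_seq_in :: "'a topology \<Rightarrow> (nat \<Rightarrow> 'a) \<Rightarrow> bool" where
  "convergent_seq_in Z xs \<longleftrightarrow> (\<exists>x. limitin Z xs x sequentially)"

definition Cauchy_seq_in :: "'a::real_vector topology \<Rightarrow> (nat \<Rightarrow> 'a) \<Rightarrow> bool" where
  "Cauchy_seq_in Z xs \<longleftrightarrow>
     (\<forall>U. openin Z U \<and> 0 \<in> U \<longrightarrow> (\<exists>N. \<forall>m\<ge>N. \<forall>n\<ge>N. xs m - xs n \<in> U))"

definition sequentially_complete :: "'a::real_vector topology \<Rightarrow> bool" where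
  "sequentially_complete Z \<longleftrightarrow> (\<forall>xs. Cauchy_seq_in Z xs \<longrightarrow> convergent_seq_in Z xs)"

definition sequentially_complete_on_bounded :: "'a::real_normed_vector topology \<Rightarrow> bool" where
  "sequentially_complete_on_bounded Z \<longleftrightarrow>
     (\<forall>xs. bounded (range xs) \<and> Cauchy_seq_in Z xs \<longrightarrow> convergent_seq_in Z xs)"

section \<open>Norming subspaces of the dual\<close>

definition norming :: "('a::real_normed_vector \<Rightarrow>\<^sub>L real) set \<Rightarrow> bool" where
  "norming \<Gamma> \<longleftrightarrow>
     subspace \<Gamma> \<and> (\<forall>x. norm x = (SUP \<gamma>\<in>{\<gamma>\<in>\<Gamma>. norm \<gamma> \<le> 1}. \<bar>blinfun_apply \<gamma> x\<bar>))"

definition topological_dual :: "'a::real_vector topology \<Rightarrow> ('a \<Rightarrow> real) set" where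
  "topological_dual Z = {\<gamma>. linear \<gamma> \<and> continuous_map Z euclideanreal \<gamma>}"

text \<open>
  In the last conjunct the dual of \<open>\<tau>\<close> is viewed inside the normed dual. No functional is lost in
  this step: by the second conjunct every \<open>\<tau>\<close>-continuous linear functional is norm-bounded.
\<close>

definition bicontinuous_admissible :: "'a::real_normed_vector topology \<Rightarrow> bool" where
  "bicontinuous_admissible \<tau> \<longleftrightarrow>
     sequentially_complete_on_bounded \<tau> \<and>
     coarser_topology \<tau> euclidean \<and>
     norming (blinfun_apply -` topological_dual \<tau>)"

section \<open>Semigroups\<close>

definition semigroup_law :: "(real \<Rightarrow> 'a \<Rightarrow> 'a) \<Rightarrow> bool" where
  "semigroup_law T \<longleftrightarrow> T 0 = id \<and> (\<forall>t\<ge>0. \<forall>s\<ge>0. T (t + s) = T t \<circ> T s)"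

definition bicontinuous_semigroup ::
    "'a::real_normed_vector topology \<Rightarrow> real \<Rightarrow> (real \<Rightarrow> 'a \<Rightarrow> 'a) \<Rightarrow> bool" where
  "bicontinuous_semigroup \<tau> \<alpha> T \<longleftrightarrow>
     (\<forall>t\<ge>0. bounded_linear (T t)) \<and>
     semigroup_law T \<and>
     (\<exists>M\<ge>0. \<forall>t\<ge>0. onorm (T t) \<le> M * exp (\<alpha> * t)) \<and>
     (\<forall>x. continuous_map (top_of_set {0..}) \<tau> (\<lambda>t. T t x)) \<and>
     (\<forall>xs x s. bounded (range xs) \<and> limitin \<tau> xs x sequentially \<and> s > 0 \<longrightarrow>
        (\<forall>U. openin \<tau> U \<and> 0 \<in> U \<longrightarrow>
           (\<exists>N. \<forall>n\<ge>N. \<forall>t\<in>{0..s}. T t (xs n) - T t x \<in> U)))"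

definition sequentially_equicontinuous ::
    "'a::real_vector topology \<Rightarrow> 'i set \<Rightarrow> ('i \<Rightarrow> 'a \<Rightarrow> 'a) \<Rightarrow> bool" where
  "sequentially_equicontinuous Z I f \<longleftrightarrow>
     (\<forall>zs z. limitin Z zs z sequentially \<longrightarrow>
        (\<forall>U. openin Z U \<and> 0 \<in> U \<longrightarrow>
           (\<exists>N. \<forall>i\<in>I. \<forall>n\<ge>N. f i (zs n) - f i z \<in> U)))"

definition C0_semigroup_on :: "'a::real_vector topology \<Rightarrow> (real \<Rightarrow> 'a \<Rightarrow> 'a) \<Rightarrow> bool" where
  "C0_semigroup_on Z T \<longleftrightarrow>
     locally_convex_topology Z \<and> Hausdorff_space Z \<and>
     (\<forall>t\<ge>0. linear (T t)) \<and>
     semigroup_law T \<and>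
     (\<forall>z. limitin Z (\<lambda>t. T t z) z (at_right 0))"

definition C0_seq_equicontinuous_semigroup ::
    "'a::real_vector topology \<Rightarrow> (real \<Rightarrow> 'a \<Rightarrow> 'a) \<Rightarrow> bool" where
  "C0_seq_equicontinuous_semigroup Z T \<longleftrightarrow>
     C0_semigroup_on Z T \<and> sequentially_equicontinuous Z {0..} T"

definition C0_seq_locally_equicontinuous_semigroup ::
    "'a::real_vector topology \<Rightarrow> (real \<Rightarrow> 'a \<Rightarrow> 'a) \<Rightarrow> bool" where
  "C0_seq_locally_equicontinuous_semigroup Z T \<longleftrightarrow>
     C0_semigroup_on Z T \<and> (\<forall>R>0. sequentially_equicontinuous Z {0..R} T)"

section \<open>Riemann integrals with values in a locally convex space\<close>

text \<open>
  The limit of Riemann sums over tagged partitions as the mesh, the largest interval length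
  \<^term>\<open>measure lborel k\<close>, tends to zero. The mesh bound is a constant, so this is the Riemann and not
  the gauge integral.
\<close>

definition has_Riemann_integral_in ::
    "'a::real_vector topology \<Rightarrow> (real \<Rightarrow> 'a) \<Rightarrow> 'a \<Rightarrow> real \<Rightarrow> real \<Rightarrow> bool" where
  "has_Riemann_integral_in Z f v a b \<longleftrightarrow>
     (\<forall>U. openin Z U \<and> 0 \<in> U \<longrightarrow>
        (\<exists>\<delta>>0. \<forall>p. p tagged_division_of {a..b} \<and> (\<forall>(x, k)\<in>p. measure lborel k < \<delta>) \<longrightarrow>
           (\<Sum>(x, k)\<in>p. measure lborel k *\<^sub>R f x) - v \<in> U))"

definition generalized_Riemann_integrable_in ::
    "'a::real_vector topology \<Rightarrow> (real \<Rightarrow> 'a) \<Rightarrow> bool" where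
  "generalized_Riemann_integrable_in Z f \<longleftrightarrow>
     (\<exists>J v. (\<forall>a\<ge>0. has_Riemann_integral_in Z f (J a) 0 a) \<and> limitin Z J v at_top)"

end

theory Submission
  imports Defs
begin

text \<open>
  The topology \<open>\<tau>'\<close> is the mixed topology of the norm and \<open>\<tau>\<close>, in the form that is most convenient for
  sequences: an absolutely convex set is a neighbourhood of zero if it eventually contains every
  norm-bounded \<open>\<tau>\<close>-null sequence. Such sets are a neighbourhood base at zero of a locally convex topology that is finer than
  \<open>\<tau>\<close> and, as norm-null sequences are bounded and \<open>\<tau>\<close>-null, coarser than the norm topology.

  Bounded \<open>\<tau>\<close>-convergent sequences converge in the mixed topology by construction. Conversely, a
  mixed-convergent sequence converges in \<open>\<tau>\<close>, and it is bounded because the \<open>\<tau>\<close>-continuous functionals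
  are norming: an unbounded sequence is thrown out of a suitable neighbourhood of zero by countably many
  such functionals (\<open>mixed_null_imp_bounded\<close>). This gives the description of convergent sequences
  (\<open>limitin_mixed_iff\<close>), and applied to differences it also gives sequential completeness.

  The definition of a bi-continuous semigroup speaks about bounded \<open>\<tau>\<close>-convergent sequences, that
  is, about mixed-convergent sequences. Strong continuity and local equicontinuity in the mixed topology
  therefore follow by testing on sequences. If \<open>\<nu> > \<alpha>\<close>, the operators \<open>exp (- \<nu> * t) *\<^sub>R T t\<close> are
  uniformly small in norm for large \<open>t\<close>, which extends equicontinuity to the half line.

  Orbits are mixed-uniformly continuous on compact intervals, so their Riemann sums are Cauchy and the
  Riemann integrals exist. The tails of the improper integral are estimated in norm, by pairing with
  norming functionals and using scalar integration (\<open>mixed_generalized_Riemann_integrable\<close>).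
\<close>

section \<open>Absolutely convex sets\<close>

definition abs_convex :: "'a::real_vector set \<Rightarrow> bool" where
  "abs_convex C \<longleftrightarrow> convex C \<and> 0 \<in> C \<and> (\<forall>x\<in>C. - x \<in> C)"

lemma abs_convex_scale:
  assumes "abs_convex C" "x \<in> C" "\<bar>r\<bar> \<le> 1"
  shows "r *\<^sub>R x \<in> C"
proof -
  have *: "s *\<^sub>R y \<in> C" if "y \<in> C" "0 \<le> s" "s \<le> 1" for s y
    using convexD[of C y 0 s "1 - s"] assms(1) that by (auto simp: abs_convex_def)
  show ?thesis
  proof (cases "r \<ge> 0")
    case True
    then show ?thesis using * assms by auto
  next
    case False
    then show ?thesis using *[of "- x" "- r"] assms by (auto simp: abs_convex_def)
  qed
qed

lemma abs_convex_midpoint: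
  assumes "abs_convex C" "2 *\<^sub>R x \<in> C" "2 *\<^sub>R y \<in> C"
  shows "x + y \<in> C"
  using convexD[of C "2 *\<^sub>R x" "2 *\<^sub>R y" "1/2" "1/2"] assms by (auto simp: abs_convex_def)

lemma abs_convex_sum:
  assumes C: "abs_convex C" and "finite I"
    and w: "\<And>i. i \<in> I \<Longrightarrow> 0 \<le> w i" and v: "\<And>i. i \<in> I \<Longrightarrow> v i \<in> C"
    and "sum w I \<le> 1"
  shows "(\<Sum>i\<in>I. w i *\<^sub>R v i) \<in> C"
proof (cases "sum w I = 0")
  case True
  then have "\<forall>i\<in>I. w i = 0"
    using w \<open>finite I\<close> by (simp add: sum_nonneg_eq_0_iff)
  then show ?thesis using C by (simp add: abs_convex_def)
next
  case False
  define W where "W = sum w I"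
  have W: "W > 0" using False w sum_nonneg[of I w] by (auto simp: W_def less_le)
  have "(\<Sum>i\<in>I. (w i / W) *\<^sub>R v i) \<in> C"
  proof (rule convex_sum)
    show "(\<Sum>i\<in>I. w i / W) = 1"
      using W by (simp add: sum_divide_distrib[symmetric] W_def)
  qed (use C W w v \<open>finite I\<close> in \<open>auto simp: abs_convex_def\<close>)
  then have "W *\<^sub>R (\<Sum>i\<in>I. (w i / W) *\<^sub>R v i) \<in> C"
    using abs_convex_scale[OF C, of _ W] W assms(5) by (simp add: W_def)
  moreover have "W *\<^sub>R (\<Sum>i\<in>I. (w i / W) *\<^sub>R v i) = (\<Sum>i\<in>I. w i *\<^sub>R v i)"
    using W by (simp add: scaleR_sum_right)
  ultimately show ?thesis by simp
qed

lemma abs_convex_Int: "abs_convex C \<Longrightarrow> abs_convex D \<Longrightarrow> abs_convex (C \<inter> D)"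
  by (auto simp: abs_convex_def convex_Int)

lemma abs_convex_vimage:
  assumes "abs_convex C" "linear f"
  shows "abs_convex (f -` C)"
  using assms by (auto simp: abs_convex_def convex_linear_vimage linear_0 linear_neg)

section \<open>Absolutely convex neighbourhoods of zero\<close>

text \<open>
  The conditions on \<open>Z\<close> below have the form "for all neighbourhoods of zero", so by local convexity they
  may be tested on these sets alone. They replace seminorms throughout: triangle inequalities become
  applications of \<open>abs_convex_midpoint\<close>.
\<close>

definition disc_nhd :: "'a::real_vector topology \<Rightarrow> 'a set \<Rightarrow> bool" where
  "disc_nhd Z C \<longleftrightarrow> abs_convex C \<and> (\<exists>V. openin Z V \<and> 0 \<in> V \<and> V \<subseteq> C)"

lemma lct_topspace: "locally_convex_topology Z \<Longrightarrow> topspace Z = UNIV"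
  by (simp add: locally_convex_topology_def)

lemma lct_continuous_add:
  assumes "locally_convex_topology Z" "continuous_map X Z f" "continuous_map X Z g"
  shows "continuous_map X Z (\<lambda>x. f x + g x)"
proof -
  have "continuous_map X (prod_topology Z Z) (\<lambda>x. (f x, g x))"
    using assms by (simp add: continuous_map_pairedI)
  moreover have "continuous_map (prod_topology Z Z) Z (\<lambda>(x, y). x + y)"
    using assms by (simp add: locally_convex_topology_def)
  ultimately show ?thesis
    using continuous_map_compose[of X _ "\<lambda>x. (f x, g x)" Z "\<lambda>(x, y). x + y"] by (simp add: o_def)
qed

lemma lct_continuous_scaleR:
  assumes "locally_convex_topology Z" "continuous_map X euclideanreal c" "continuous_map X Z g"
  shows "continuous_map X Z (\<lambda>x. c x *\<^sub>R g x)"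
proof -
  have "continuous_map X (prod_topology euclideanreal Z) (\<lambda>x. (c x, g x))"
    using assms by (simp add: continuous_map_pairedI)
  moreover have "continuous_map (prod_topology euclideanreal Z) Z (\<lambda>(c, x). c *\<^sub>R x)"
    using assms by (simp add: locally_convex_topology_def)
  ultimately show ?thesis
    using continuous_map_compose[of X _ "\<lambda>x. (c x, g x)" Z "\<lambda>(c, x). c *\<^sub>R x"] by (simp add: o_def)
qed

lemma lct_openin_translate:
  assumes "locally_convex_topology Z" "openin Z U"
  shows "openin Z {y. x + y \<in> U}"
  using openin_continuous_map_preimage[OF lct_continuous_add[OF assms(1), of Z "\<lambda>_. x" "\<lambda>y. y"] assms(2)]
  by (simp add: lct_topspace[OF assms(1)])

lemma lct_openin_scale:
  assumes "locally_convex_topology Z" "openin Z U"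
  shows "openin Z {y. r *\<^sub>R y \<in> U}"
  using openin_continuous_map_preimage[OF lct_continuous_scaleR[OF assms(1), of Z "\<lambda>_. r" "\<lambda>y. y"] assms(2)]
  by (simp add: lct_topspace[OF assms(1)])

lemma disc_nhd_scale:
  assumes "locally_convex_topology Z" "disc_nhd Z C"
  shows "disc_nhd Z {x. r *\<^sub>R x \<in> C}"
proof -
  obtain V where V: "openin Z V" "0 \<in> V" "V \<subseteq> C"
    using assms(2) by (auto simp: disc_nhd_def)
  have "abs_convex ((\<lambda>x. r *\<^sub>R x) -` C)"
    using assms(2) by (intro abs_convex_vimage linear_scale_self) (auto simp: disc_nhd_def)
  moreover have "openin Z {x. r *\<^sub>R x \<in> V}" using lct_openin_scale[OF assms(1) V(1)] .
  ultimately show ?thesis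
    using V unfolding disc_nhd_def vimage_def by (intro conjI exI[of _ "{x. r *\<^sub>R x \<in> V}"]) auto
qed

lemma disc_nhd_base:
  assumes Z: "locally_convex_topology Z" and "openin Z U" "0 \<in> U"
  obtains C where "disc_nhd Z C" "C \<subseteq> U"
proof -
  obtain C V where C: "convex C" "C \<subseteq> U" and V: "openin Z V" "0 \<in> V" "V \<subseteq> C"
    using assms unfolding locally_convex_topology_def by meson
  let ?n = "\<lambda>S. {x. (- 1::real) *\<^sub>R x \<in> S}"
  have "convex (?n C)"
    using convex_linear_vimage[OF linear_scale_self[of "-1::real"] C(1)] by (simp add: vimage_def)
  then have "abs_convex (C \<inter> ?n C)"
    using C V by (auto simp: abs_convex_def intro: convex_Int)
  moreover have "openin Z (V \<inter> ?n V)"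
    using lct_openin_scale[OF Z V(1)] V(1) by blast
  ultimately have "disc_nhd Z (C \<inter> ?n C)"
    using V unfolding disc_nhd_def by (intro conjI exI[of _ "V \<inter> ?n V"]) auto
  then show ?thesis using C that by blast
qed

text \<open>
  The common reason why convergence, the Cauchy property, equicontinuity and the Riemann integral can
  be tested on absolutely convex neighbourhoods: each is monotone in the neighbourhood.
\<close>

lemma all_open_iff_all_disc_nhd:
  assumes "locally_convex_topology Z" "\<And>U W. U \<subseteq> W \<Longrightarrow> P U \<Longrightarrow> P W"
  shows "(\<forall>U. openin Z U \<and> 0 \<in> U \<longrightarrow> P U) \<longleftrightarrow> (\<forall>C. disc_nhd Z C \<longrightarrow> P C)"
  by (meson assms disc_nhd_base disc_nhd_def)

lemma limitin_iff_disc_nhd: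
  assumes Z: "locally_convex_topology Z"
  shows "limitin Z f x F \<longleftrightarrow> (\<forall>C. disc_nhd Z C \<longrightarrow> (\<forall>\<^sub>F n in F. f n - x \<in> C))"
proof -
  have "limitin Z f x F \<longleftrightarrow> (\<forall>U. openin Z U \<and> 0 \<in> U \<longrightarrow> (\<forall>\<^sub>F n in F. f n - x \<in> U))"
  proof safe
    fix U assume "limitin Z f x F" "openin Z U" "0 \<in> U"
    moreover have "openin Z {y. - x + y \<in> U}" using lct_openin_translate[OF Z \<open>openin Z U\<close>] .
    ultimately have "\<forall>\<^sub>F n in F. f n \<in> {y. - x + y \<in> U}"
      unfolding limitin_def by (metis (mono_tags) mem_Collect_eq add.left_inverse)
    then show "\<forall>\<^sub>F n in F. f n - x \<in> U" by simp
  next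
    assume *: "\<forall>U. openin Z U \<and> 0 \<in> U \<longrightarrow> (\<forall>\<^sub>F n in F. f n - x \<in> U)"
    show "limitin Z f x F" unfolding limitin_def
    proof (intro conjI allI impI)
      fix U assume "openin Z U \<and> x \<in> U"
      then have "\<forall>\<^sub>F n in F. f n - x \<in> {y. x + y \<in> U}"
        using * lct_openin_translate[OF Z, of U x] by auto
      then show "\<forall>\<^sub>F n in F. f n \<in> U" by simp
    qed (simp add: lct_topspace[OF Z])
  qed
  also have "\<dots> \<longleftrightarrow> (\<forall>C. disc_nhd Z C \<longrightarrow> (\<forall>\<^sub>F n in F. f n - x \<in> C))"
    by (rule all_open_iff_all_disc_nhd[OF Z]) (auto elim: eventually_mono)
  finally show ?thesis .
qed

lemma Cauchy_seq_in_iff_disc_nhd: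
  assumes "locally_convex_topology Z"
  shows "Cauchy_seq_in Z xs \<longleftrightarrow>
    (\<forall>C. disc_nhd Z C \<longrightarrow> (\<exists>N. \<forall>m\<ge>N. \<forall>n\<ge>N. xs m - xs n \<in> C))"
  unfolding Cauchy_seq_in_def by (rule all_open_iff_all_disc_nhd[OF assms]) blast

lemma sequentially_equicontinuous_iff_disc_nhd:
  assumes "locally_convex_topology Z"
  shows "sequentially_equicontinuous Z I f \<longleftrightarrow>
    (\<forall>zs z. limitin Z zs z sequentially \<longrightarrow>
      (\<forall>C. disc_nhd Z C \<longrightarrow> (\<exists>N. \<forall>i\<in>I. \<forall>n\<ge>N. f i (zs n) - f i z \<in> C)))"
  unfolding sequentially_equicontinuous_def
  by (subst all_open_iff_all_disc_nhd[OF assms]) blast+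

lemma has_Riemann_integral_in_iff_disc_nhd:
  assumes "locally_convex_topology Z"
  shows "has_Riemann_integral_in Z f v a b \<longleftrightarrow>
    (\<forall>C. disc_nhd Z C \<longrightarrow>
        (\<exists>\<delta>>0. \<forall>p. p tagged_division_of {a..b} \<and> (\<forall>(x, k)\<in>p. measure lborel k < \<delta>) \<longrightarrow>
           (\<Sum>(x, k)\<in>p. measure lborel k *\<^sub>R f x) - v \<in> C))"
  unfolding has_Riemann_integral_in_def
  by (rule all_open_iff_all_disc_nhd[OF assms]) blast

section \<open>Locally convex topologies from absolutely convex sets\<close>

definition disc_base :: "'a::real_vector set set \<Rightarrow> bool" where
  "disc_base B \<longleftrightarrow> B \<noteq> {} \<and>
     (\<forall>C\<in>B. abs_convex C \<and> (\<forall>x. \<exists>e>0. e *\<^sub>R x \<in> C) \<and> (\<forall>r. {x. r *\<^sub>R x \<in> C} \<in> B)) \<and>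
     (\<forall>C\<in>B. \<forall>D\<in>B. C \<inter> D \<in> B)"

lemma disc_baseD:
  assumes "disc_base B" "C \<in> B"
  shows "abs_convex C" "\<exists>e>0. e *\<^sub>R x \<in> C" "{x. r *\<^sub>R x \<in> C} \<in> B" "D \<in> B \<Longrightarrow> C \<inter> D \<in> B"
  using assms unfolding disc_base_def by blast+

text \<open>
  A family satisfying the preceding conditions need not consist of open sets, only of neighbourhoods
  of zero. A set is therefore declared open if around each of its points it contains a translate of a
  member of the family.
\<close>

definition topology_of_discs :: "'a::real_vector set set \<Rightarrow> 'a topology" where
  "topology_of_discs B = topology (\<lambda>U. \<forall>x\<in>U. \<exists>C\<in>B. \<forall>c\<in>C. x + c \<in> U)"

lemma openin_topology_of_discs:
  assumes "disc_base B"
  shows "openin (topology_of_discs B) U \<longleftrightarrow> (\<forall>x\<in>U. \<exists>C\<in>B. \<forall>c\<in>C. x + c \<in> U)"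
proof -
  have "istopology (\<lambda>U. \<forall>x\<in>U. \<exists>C\<in>B. \<forall>c\<in>C. x + c \<in> U)"
    unfolding istopology_def
  proof (intro conjI allI impI ballI)
    fix S T x assume *: "\<forall>x\<in>S. \<exists>C\<in>B. \<forall>c\<in>C. x + c \<in> S" "\<forall>x\<in>T. \<exists>C\<in>B. \<forall>c\<in>C. x + c \<in> T" "x \<in> S \<inter> T"
    then obtain C D where "C \<in> B" "\<forall>c\<in>C. x + c \<in> S" "D \<in> B" "\<forall>c\<in>D. x + c \<in> T" by blast
    moreover have "C \<inter> D \<in> B" using \<open>C \<in> B\<close> \<open>D \<in> B\<close> disc_baseD(4)[OF assms] by blast
    ultimately show "\<exists>C\<in>B. \<forall>c\<in>C. x + c \<in> S \<inter> T" by (intro bexI[of _ "C \<inter> D"]) auto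
  next
    fix K x assume *: "\<forall>S\<in>K. \<forall>x\<in>S. \<exists>C\<in>B. \<forall>c\<in>C. x + c \<in> S" "x \<in> \<Union>K"
    then obtain S where "S \<in> K" "x \<in> S" by blast
    moreover from this obtain C where "C \<in> B" "\<forall>c\<in>C. x + c \<in> S" using * by blast
    ultimately show "\<exists>C\<in>B. \<forall>c\<in>C. x + c \<in> \<Union>K" by blast
  qed
  then show ?thesis by (simp add: topology_of_discs_def topology_inverse')
qed

text \<open>
  The interior of \<open>C\<close> can be written down as the set of all \<open>x\<close> with \<open>x + D \<subseteq> C\<close> for some \<open>D\<close> in the
  family. It is open because \<open>D\<close> contains the sum of two copies of its half.
\<close>

lemma disc_base_open_subset:
  assumes B: "disc_base B" and C: "C \<in> B"
  obtains V where "openin (topology_of_discs B) V" "0 \<in> V" "V \<subseteq> C"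
proof -
  let ?V = "{x. \<exists>D\<in>B. \<forall>d\<in>D. x + d \<in> C}"
  have 1: "openin (topology_of_discs B) ?V"
    unfolding openin_topology_of_discs[OF B]
  proof clarify
    fix x D assume D: "D \<in> B" "\<forall>d\<in>D. x + d \<in> C"
    let ?D = "{x. 2 *\<^sub>R x \<in> D}"
    have D': "?D \<in> B" "abs_convex D" by (rule disc_baseD[OF B D(1)])+
    have "x + c + d \<in> C" if "c \<in> ?D" "d \<in> ?D" for c d
      using abs_convex_midpoint[OF D'(2), of c d] that D by (auto simp: add.assoc)
    then show "\<exists>E\<in>B. \<forall>c\<in>E. x + c \<in> ?V" using D' by blast
  qed
  have 2: "0 \<in> ?V" using C by auto
  have 3: "?V \<subseteq> C"
  proof clarify
    fix x D assume "D \<in> B" and D: "\<forall>d\<in>D. x + d \<in> C"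
    then have "0 \<in> D" using disc_baseD(1)[OF B] by (simp add: abs_convex_def)
    then have "x + 0 \<in> C" using D by blast
    then show "x \<in> C" by simp
  qed
  show thesis by (rule that[OF 1 2 3])
qed

lemma disc_base_absorbing:
  assumes B: "disc_base B" and C: "C \<in> B"
  obtains e where "e > 0" "\<And>r. \<bar>r\<bar> \<le> e \<Longrightarrow> r *\<^sub>R x \<in> C"
proof -
  obtain e where e: "e > 0" "e *\<^sub>R x \<in> C"
    using disc_baseD(2)[OF B C, of x] by blast
  note ac = disc_baseD(1)[OF B C]
  have "r *\<^sub>R x \<in> C" if "\<bar>r\<bar> \<le> e" for r
    using abs_convex_scale[OF ac e(2), of "r / e"] e(1) that by simp
  then show ?thesis using e that by blast
qed

lemma locally_convex_topology_of_discs: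
  assumes B: "disc_base B"
  shows "locally_convex_topology (topology_of_discs B)"
proof -
  let ?Z = "topology_of_discs B"
  note op = openin_topology_of_discs[OF B]
  note ac = disc_baseD(1)[OF B] and sc = disc_baseD(3)[OF B]
  have top: "topspace ?Z = UNIV"
  proof -
    have "openin ?Z UNIV" unfolding op using B unfolding disc_base_def by blast
    then show ?thesis using openin_subset by blast
  qed
  have transl: "openin ?Z {y. y - x \<in> U}" if "openin ?Z U" for x U
    unfolding op
  proof (intro ballI)
    fix y assume "y \<in> {y. y - x \<in> U}"
    then have "y - x \<in> U" by simp
    then obtain C where "C \<in> B" "\<forall>c\<in>C. (y - x) + c \<in> U" using \<open>openin ?Z U\<close> unfolding op by blast
    moreover have "(y - x) + c = y + c - x" for c by simp
    ultimately show "\<exists>C\<in>B. \<forall>c\<in>C. y + c \<in> {y. y - x \<in> U}" by auto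
  qed
  have "continuous_map (prod_topology ?Z ?Z) ?Z (\<lambda>(x, y). x + y)"
    unfolding continuous_map_def openin_prod_topology_alt
  proof (clarsimp simp: top, goal_cases)
    case (1 U x y)
    then obtain C where C: "C \<in> B" "\<forall>c\<in>C. (x + y) + c \<in> U" unfolding op by blast
    obtain V where V: "openin ?Z V" "0 \<in> V" "V \<subseteq> {x. 2 *\<^sub>R x \<in> C}"
      using disc_base_open_subset[OF B sc[OF C(1)]] by blast
    have "v + w \<in> U" if "v - x \<in> V" "w - y \<in> V" for v w
    proof -
      have "(v - x) + (w - y) \<in> C"
        using V(3) that by (intro abs_convex_midpoint ac C) auto
      then have "(x + y) + ((v - x) + (w - y)) \<in> U" using C(2) by blast
      then show ?thesis by (simp add: algebra_simps)
    qed
    then show ?case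
      using V transl by (intro exI[of _ "{v. v - x \<in> V}"] conjI exI[of _ "{v. v - y \<in> V}"]) auto
  qed
  moreover have "continuous_map (prod_topology euclideanreal ?Z) ?Z (\<lambda>(c, x). c *\<^sub>R x)"
    unfolding continuous_map_def openin_prod_topology_alt
  proof (clarsimp simp: top, goal_cases)
    case (1 U r x)
    then obtain C where C: "C \<in> B" "\<forall>c\<in>C. r *\<^sub>R x + c \<in> U" unfolding op by blast
    obtain e where e: "e > 0" "\<And>s. \<bar>s\<bar> \<le> e \<Longrightarrow> s *\<^sub>R x \<in> {x. 2 *\<^sub>R x \<in> C}"
      using disc_base_absorbing[OF B sc[OF C(1)]] by blast
    define K where "K = \<bar>r\<bar> + e"
    have K: "K > 0" using e by (simp add: K_def)
    obtain V where V: "openin ?Z V" "0 \<in> V" "V \<subseteq> {x. (2 * K) *\<^sub>R x \<in> C}"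
      using disc_base_open_subset[OF B sc[OF C(1)]] by blast
    have "s *\<^sub>R v \<in> U" if "s \<in> ball r e" "v - x \<in> V" for s v
    proof -
      have s: "\<bar>s - r\<bar> \<le> e" "\<bar>s\<bar> \<le> K" using that by (auto simp: dist_real_def K_def)
      have "(2 * K) *\<^sub>R (v - x) \<in> C" using V that by auto
      then have "(s / K) *\<^sub>R ((2 * K) *\<^sub>R (v - x)) \<in> C"
        by (rule abs_convex_scale[OF ac[OF C(1)]]) (use s K in auto)
      then have "2 *\<^sub>R (s *\<^sub>R (v - x)) \<in> C" using K by (simp add: mult.commute)
      moreover have "2 *\<^sub>R ((s - r) *\<^sub>R x) \<in> C" using e(2)[OF s(1)] by simp
      ultimately have "(s - r) *\<^sub>R x + s *\<^sub>R (v - x) \<in> C"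
        by (intro abs_convex_midpoint ac C) auto
      then have "r *\<^sub>R x + ((s - r) *\<^sub>R x + s *\<^sub>R (v - x)) \<in> U" using C(2) by blast
      then show ?thesis by (simp add: algebra_simps)
    qed
    then show ?case
      using V transl e by (intro exI[of _ "ball r e"] conjI exI[of _ "{v. v - x \<in> V}"]) auto
  qed
  moreover have "\<exists>C V. convex C \<and> C \<subseteq> U \<and> openin ?Z V \<and> 0 \<in> V \<and> V \<subseteq> C"
    if U: "openin ?Z U" "0 \<in> U" for U
  proof -
    obtain C where C: "C \<in> B" "C \<subseteq> U" using U unfolding op by force
    then show ?thesis using disc_base_open_subset[OF B C(1)] ac[OF C(1)]
      by (metis abs_convex_def)
  qed
  ultimately show ?thesis unfolding locally_convex_topology_def using top by blast
qed

text \<open>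
  If the family is closed under passing to absolutely convex supersets, no new absolutely convex
  neighbourhoods arise, and the topology can be handled through the defining condition of the family.
\<close>

lemma disc_nhd_topology_of_discs:
  assumes B: "disc_base B" and upward: "\<And>C D. C \<in> B \<Longrightarrow> C \<subseteq> D \<Longrightarrow> abs_convex D \<Longrightarrow> D \<in> B"
  shows "disc_nhd (topology_of_discs B) C \<longleftrightarrow> C \<in> B"
proof
  assume "C \<in> B"
  then show "disc_nhd (topology_of_discs B) C"
    using disc_base_open_subset[OF B, of C] disc_baseD(1)[OF B] unfolding disc_nhd_def by metis
next
  assume "disc_nhd (topology_of_discs B) C"
  then obtain V where V: "abs_convex C" "openin (topology_of_discs B) V" "0 \<in> V" "V \<subseteq> C"
    by (auto simp: disc_nhd_def)
  then obtain D where "D \<in> B" "D \<subseteq> V"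
    unfolding openin_topology_of_discs[OF B] by force
  then show "C \<in> B" using upward V by blast
qed

section \<open>Norming functionals\<close>

text \<open>
  The two uses of the norming property: estimates of a norm are reduced to estimates of scalars, and, by
  contraposition, a vector of large norm is detected by a functional of norm at most one.
\<close>

lemma norming_le:
  assumes "norming \<Gamma>" and "\<And>\<gamma>. \<gamma> \<in> \<Gamma> \<Longrightarrow> norm \<gamma> \<le> 1 \<Longrightarrow> \<bar>blinfun_apply \<gamma> x\<bar> \<le> B"
  shows "norm x \<le> B"
proof -
  have "0 \<in> \<Gamma>" using assms(1) by (simp add: norming_def subspace_0)
  then have "(SUP \<gamma>\<in>{\<gamma>\<in>\<Gamma>. norm \<gamma> \<le> 1}. \<bar>blinfun_apply \<gamma> x\<bar>) \<le> B"
    using assms(2) by (intro cSUP_least) force+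
  then show ?thesis using assms(1) unfolding norming_def by metis
qed

section \<open>The mixed topology\<close>

definition bounded_null_seq :: "'a::real_normed_vector topology \<Rightarrow> (nat \<Rightarrow> 'a) \<Rightarrow> bool" where
  "bounded_null_seq \<tau> xs \<longleftrightarrow> bounded (range xs) \<and> limitin \<tau> xs 0 sequentially"

text \<open>
  The absolutely convex neighbourhoods of zero of the finest locally convex topology in which all norm-bounded
  \<open>\<tau>\<close>-null sequences converge to zero. Convergence of these sequences is thus built in, and what has
  to be proved is that no other sequence converges.
\<close>

definition mixed_discs :: "'a::real_normed_vector topology \<Rightarrow> 'a set set" where
  "mixed_discs \<tau> = {C. abs_convex C \<and> (\<forall>xs. bounded_null_seq \<tau> xs \<longrightarrow> (\<forall>\<^sub>F n in sequentially. xs n \<in> C))}"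

definition mixed_topology :: "'a::real_normed_vector topology \<Rightarrow> 'a topology" where
  "mixed_topology \<tau> = topology_of_discs (mixed_discs \<tau>)"

lemma coarser_limitin:
  assumes "coarser_topology S Z" "limitin Z f x F" "topspace S = UNIV"
  shows "limitin S f x F"
  using assms unfolding coarser_topology_def limitin_def by auto

lemma bounded_null_seq_scale:
  assumes "locally_convex_topology \<tau>" "bounded_null_seq \<tau> xs"
  shows "bounded_null_seq \<tau> (\<lambda>n. r *\<^sub>R xs n)"
proof -
  have "bounded (range (\<lambda>n. r *\<^sub>R xs n))"
    using bounded_scaling[of "range xs" r] assms(2) by (simp add: bounded_null_seq_def image_image)
  moreover have "limitin \<tau> (\<lambda>n. r *\<^sub>R xs n) 0 sequentially"
    unfolding limitin_iff_disc_nhd[OF assms(1)]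
  proof (intro allI impI)
    fix C assume "disc_nhd \<tau> C"
    then have "disc_nhd \<tau> {x. r *\<^sub>R x \<in> C}" by (rule disc_nhd_scale[OF assms(1)])
    then show "\<forall>\<^sub>F n in sequentially. r *\<^sub>R xs n - 0 \<in> C"
      using assms(2) by (force simp: bounded_null_seq_def limitin_iff_disc_nhd[OF assms(1)])
  qed
  ultimately show ?thesis by (simp add: bounded_null_seq_def)
qed

lemma bounded_null_seq_of_norm_null:
  assumes "locally_convex_topology \<tau>" "coarser_topology \<tau> euclidean" "xs \<longlonglongrightarrow> 0"
  shows "bounded_null_seq \<tau> xs"
  unfolding bounded_null_seq_def
proof
  show "bounded (range xs)" using assms(3) by (simp add: convergent_imp_bounded)
  show "limitin \<tau> xs 0 sequentially"
    using assms by (intro coarser_limitin[OF assms(2)]) (auto simp: lct_topspace)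
qed

text \<open>
  The condition that needs an argument is absorption: \<open>x / n\<close> tends to zero in norm, hence is a bounded \<open>\<tau>\<close>-null
  sequence and reaches \<open>C\<close>.
\<close>

lemma disc_base_mixed_discs:
  fixes \<tau> :: "'a::real_normed_vector topology"
  assumes "locally_convex_topology \<tau>" "coarser_topology \<tau> euclidean"
  shows "disc_base (mixed_discs \<tau>)"
  unfolding disc_base_def
proof (intro conjI ballI allI)
  have "UNIV \<in> mixed_discs \<tau>" by (simp add: mixed_discs_def abs_convex_def)
  then show "mixed_discs \<tau> \<noteq> {}" by blast
next
  fix C assume "C \<in> mixed_discs \<tau>"
  then show "abs_convex C" by (simp add: mixed_discs_def)
next
  fix C and x :: 'a assume C: "C \<in> mixed_discs \<tau>"
  have "(\<lambda>n. 1 / real (Suc n)) \<longlonglongrightarrow> 0" by (rule LIMSEQ_Suc[OF lim_1_over_n])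
  then have "(\<lambda>n. (1 / real (Suc n)) *\<^sub>R x) \<longlonglongrightarrow> 0 *\<^sub>R x"
    by (rule tendsto_scaleR[OF _ tendsto_const])
  then have "bounded_null_seq \<tau> (\<lambda>n. (1 / real (Suc n)) *\<^sub>R x)"
    by (intro bounded_null_seq_of_norm_null assms) simp
  then obtain n where "(1 / real (Suc n)) *\<^sub>R x \<in> C"
    using C by (force simp: mixed_discs_def eventually_sequentially)
  then show "\<exists>e>0. e *\<^sub>R x \<in> C" by (intro exI[of _ "1 / real (Suc n)"]) auto
next
  fix C and r :: real assume C: "C \<in> mixed_discs \<tau>"
  have "abs_convex {x. r *\<^sub>R x \<in> C}"
    using C abs_convex_vimage[of C "\<lambda>x. r *\<^sub>R x"] by (auto simp: mixed_discs_def vimage_def)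
  then show "{x. r *\<^sub>R x \<in> C} \<in> mixed_discs \<tau>"
    using C bounded_null_seq_scale[OF assms(1)] by (auto simp: mixed_discs_def)
next
  fix C D assume "C \<in> mixed_discs \<tau>" "D \<in> mixed_discs \<tau>"
  then show "C \<inter> D \<in> mixed_discs \<tau>"
    by (auto simp: mixed_discs_def abs_convex_Int eventually_conj)
qed

lemma locally_convex_mixed_topology:
  assumes "locally_convex_topology \<tau>" "coarser_topology \<tau> euclidean"
  shows "locally_convex_topology (mixed_topology \<tau>)"
  unfolding mixed_topology_def
  by (rule locally_convex_topology_of_discs[OF disc_base_mixed_discs[OF assms]])

lemma disc_nhd_mixed_iff:
  assumes "locally_convex_topology \<tau>" "coarser_topology \<tau> euclidean"
  shows "disc_nhd (mixed_topology \<tau>) C \<longleftrightarrow> C \<in> mixed_discs \<tau>"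
  unfolding mixed_topology_def
proof (rule disc_nhd_topology_of_discs[OF disc_base_mixed_discs[OF assms]])
  fix C D assume "C \<in> mixed_discs \<tau>" "C \<subseteq> D" "abs_convex D"
  then show "D \<in> mixed_discs \<tau>"
    unfolding mixed_discs_def by (auto elim!: allE intro: eventually_mono)
qed

lemma coarser_mixed_topology:
  assumes "locally_convex_topology \<tau>" "coarser_topology \<tau> euclidean"
  shows "coarser_topology \<tau> (mixed_topology \<tau>)"
  unfolding coarser_topology_def mixed_topology_def
    openin_topology_of_discs[OF disc_base_mixed_discs[OF assms]]
proof (intro allI impI ballI)
  fix U x assume U: "openin \<tau> U" "x \<in> U"
  obtain C where C: "disc_nhd \<tau> C" "C \<subseteq> {y. x + y \<in> U}"
    using disc_nhd_base[OF assms(1) lct_openin_translate[OF assms(1) U(1), of x]] U by auto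
  then have "C \<in> mixed_discs \<tau>"
    by (auto simp: mixed_discs_def bounded_null_seq_def limitin_iff_disc_nhd[OF assms(1)] disc_nhd_def)
  then show "\<exists>C\<in>mixed_discs \<tau>. \<forall>c\<in>C. x + c \<in> U" using C by blast
qed

text \<open>
  If no ball lay in \<open>C\<close>, a norm-null sequence outside \<open>C\<close> would exist; but it is a bounded
  \<open>\<tau>\<close>-null sequence.
\<close>

lemma mixed_discs_contains_ball:
  assumes "locally_convex_topology \<tau>" "coarser_topology \<tau> euclidean" "C \<in> mixed_discs \<tau>"
  obtains e where "e > 0" "\<And>x. norm x < e \<Longrightarrow> x \<in> C"
proof (rule ccontr)
  assume no: "\<not> thesis"
  have "\<exists>x. norm x < 1 / real (Suc n) \<and> x \<notin> C" for n
    using no that[of "1 / real (Suc n)"] by auto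
  then obtain xs where xs: "\<And>n. norm (xs n) < 1 / real (Suc n)" "\<And>n. xs n \<notin> C" by metis
  have "xs \<longlonglongrightarrow> 0"
    by (rule Lim_null_comparison[OF _ LIMSEQ_Suc[OF lim_1_over_n]])
      (use xs(1) in \<open>auto intro!: always_eventually less_imp_le\<close>)
  then have "bounded_null_seq \<tau> xs" by (rule bounded_null_seq_of_norm_null[OF assms(1,2)])
  then show False using assms(3) xs(2) by (auto simp: mixed_discs_def)
qed

lemma mixed_topology_coarser_norm:
  assumes "locally_convex_topology \<tau>" "coarser_topology \<tau> euclidean"
  shows "coarser_topology (mixed_topology \<tau>) euclidean"
  unfolding coarser_topology_def
proof (intro allI impI)
  fix U assume "openin (mixed_topology \<tau>) U"
  then have U: "\<forall>x\<in>U. \<exists>C\<in>mixed_discs \<tau>. \<forall>c\<in>C. x + c \<in> U"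
    by (simp add: mixed_topology_def openin_topology_of_discs[OF disc_base_mixed_discs[OF assms]])
  have "open U" unfolding open_dist
  proof
    fix x assume "x \<in> U"
    then obtain C where C: "C \<in> mixed_discs \<tau>" "\<forall>c\<in>C. x + c \<in> U" using U by blast
    obtain e where e: "e > 0" "\<And>x. norm x < e \<Longrightarrow> x \<in> C"
      using mixed_discs_contains_ball[OF assms C(1)] by blast
    have "y \<in> U" if "dist y x < e" for y
      using C(2) e(2)[of "y - x"] that by (force simp: dist_norm)
    then show "\<exists>e>0. \<forall>y. dist y x < e \<longrightarrow> y \<in> U" using e(1) by blast
  qed
  then show "openin euclidean U" by simp
qed

lemma Hausdorff_mixed_topology:
  assumes "locally_convex_topology \<tau>" "coarser_topology \<tau> euclidean" "Hausdorff_space \<tau>"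
  shows "Hausdorff_space (mixed_topology \<tau>)"
  using assms(3) coarser_mixed_topology[OF assms(1,2)]
    lct_topspace[OF assms(1)] lct_topspace[OF locally_convex_mixed_topology[OF assms(1,2)]]
  unfolding Hausdorff_space_def coarser_topology_def by metis

lemma bounded_range_of_tail:
  assumes "bounded (xs ` {n..})"
  shows "bounded (range (xs :: nat \<Rightarrow> 'a::metric_space))"
proof -
  have "range xs = xs ` {..<n} \<union> xs ` {n..}" by (auto simp: image_Un[symmetric] not_less)
  then show ?thesis using assms by (simp add: finite_imp_bounded)
qed

text \<open>
  The heart of the construction. If \<open>xs\<close> is unbounded, pick terms \<open>xs (k n)\<close> with \<open>k n \<ge> n\<close> and norm
  above \<open>n + 1\<close>, and detect each by a \<open>\<tau>\<close>-continuous functional \<open>\<gamma> n\<close> of norm at most one, available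
  since the dual of \<open>\<tau>\<close> is norming. The set where \<open>\<bar>\<gamma> n\<bar> \<le> n + 1\<close> for all \<open>n\<close> is a mixed
  neighbourhood of zero: on a bounded sequence the conditions with large \<open>n\<close> hold automatically, and
  the finitely many others hold eventually along a \<open>\<tau>\<close>-null sequence. It misses every \<open>xs (k n)\<close>.
\<close>

lemma mixed_null_imp_bounded:
  assumes lct: "locally_convex_topology \<tau>" and adm: "bicontinuous_admissible \<tau>"
    and null: "\<And>C. C \<in> mixed_discs \<tau> \<Longrightarrow> \<forall>\<^sub>F n in sequentially. xs n \<in> C"
  shows "bounded (range xs)"
proof (rule ccontr)
  let ?\<Gamma> = "blinfun_apply -` topological_dual \<tau>"
  assume unb: "\<not> bounded (range xs)"
  have far: "\<exists>k\<ge>n. norm (xs k) > real (Suc n)" for n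
  proof (rule ccontr)
    assume "\<not> ?thesis"
    then have "xs ` {n..} \<subseteq> cball 0 (real (Suc n))" by (auto simp: not_less)
    then show False using unb bounded_range_of_tail bounded_subset[OF bounded_cball] by blast
  qed
  then obtain k where k: "\<And>n. k n \<ge> n" "\<And>n. norm (xs (k n)) > real (Suc n)" by metis
  have nm: "norming ?\<Gamma>" using adm by (simp add: bicontinuous_admissible_def)
  have "\<exists>\<gamma>. \<gamma> \<in> ?\<Gamma> \<and> norm \<gamma> \<le> 1 \<and> \<bar>blinfun_apply \<gamma> (xs (k n))\<bar> > real (Suc n)" for n
    using norming_le[OF nm, of "xs (k n)" "real (Suc n)"] k(2)[of n] by (meson not_less)
  then obtain \<gamma> where \<gamma>: "\<And>n. \<gamma> n \<in> ?\<Gamma>" "\<And>n. norm (\<gamma> n) \<le> 1"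
      "\<And>n. \<bar>blinfun_apply (\<gamma> n) (xs (k n))\<bar> > real (Suc n)" by metis
  define C where "C = {x. \<forall>n. \<bar>blinfun_apply (\<gamma> n) x\<bar> \<le> real (Suc n)}"
  have "C \<in> mixed_discs \<tau>" unfolding mixed_discs_def
  proof safe
    have C': "C = (\<Inter>n. blinfun_apply (\<gamma> n) -` {- real (Suc n)..real (Suc n)})"
      unfolding C_def by (auto simp only: abs_le_iff minus_le_iff vimage_eq atLeastAtMost_iff)
    have "convex C" unfolding C'
      by (intro convex_INT convex_linear_vimage) (auto intro: bounded_linear.linear blinfun.bounded_linear_right)
    then show "abs_convex C" by (auto simp: abs_convex_def C_def blinfun.minus_right blinfun.zero_right)
  next
    fix zs assume zs: "bounded_null_seq \<tau> zs"
    then obtain K where K: "\<And>j. norm (zs j) \<le> K" by (auto simp: bounded_null_seq_def bounded_iff)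
    \<comment> \<open>Only the conditions with index below \<open>m\<close> restrict the sequence \<open>zs\<close>.\<close>
    obtain m where m: "K \<le> real m" using real_arch_simple by blast
    have "\<forall>\<^sub>F j in sequentially. \<bar>blinfun_apply (\<gamma> n) (zs j)\<bar> < 1" for n
    proof -
      have "continuous_map \<tau> euclideanreal (blinfun_apply (\<gamma> n))"
        using \<gamma>(1)[of n] by (simp add: topological_dual_def)
      then have "limitin euclideanreal (blinfun_apply (\<gamma> n) \<circ> zs) (blinfun_apply (\<gamma> n) 0) sequentially"
        using zs by (intro continuous_map_limit) (auto simp: bounded_null_seq_def)
      then have "(\<lambda>j. blinfun_apply (\<gamma> n) (zs j)) \<longlonglongrightarrow> 0"
        by (simp add: o_def blinfun.zero_right)
      from tendstoD[OF this, of 1] show ?thesis by (simp add: dist_real_def)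
    qed
    then have "\<forall>\<^sub>F j in sequentially. \<forall>n\<in>{..<m}. \<bar>blinfun_apply (\<gamma> n) (zs j)\<bar> < 1"
      by (intro eventually_ball_finite) auto
    then show "\<forall>\<^sub>F j in sequentially. zs j \<in> C"
    proof (rule eventually_mono)
      fix j assume j: "\<forall>n\<in>{..<m}. \<bar>blinfun_apply (\<gamma> n) (zs j)\<bar> < 1"
      have "\<bar>blinfun_apply (\<gamma> n) (zs j)\<bar> \<le> real (Suc n)" for n
      proof (cases "n < m")
        case True
        then have "\<bar>blinfun_apply (\<gamma> n) (zs j)\<bar> < 1" using j by auto
        then show ?thesis by simp
      next
        case False
        have "\<bar>blinfun_apply (\<gamma> n) (zs j)\<bar> \<le> norm (\<gamma> n) * norm (zs j)"
          using norm_blinfun[of "\<gamma> n" "zs j"] by simp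
        also have "\<dots> \<le> 1 * K" using \<gamma>(2) K by (intro mult_mono) auto
        also have "\<dots> \<le> real (Suc n)" using m False by simp
        finally show ?thesis .
      qed
      then show "zs j \<in> C" by (simp add: C_def)
    qed
  qed
  then obtain N where "\<And>n. n \<ge> N \<Longrightarrow> xs n \<in> C" using null by (force simp: eventually_sequentially)
  then have "xs (k N) \<in> C" using k by blast
  then have "\<bar>blinfun_apply (\<gamma> N) (xs (k N))\<bar> \<le> real (Suc N)" unfolding C_def by blast
  then show False using \<gamma>(3)[of N] by linarith
qed

lemma limitin_mixed_iff:
  assumes lct: "locally_convex_topology \<tau>" and adm: "bicontinuous_admissible \<tau>"
  shows "limitin (mixed_topology \<tau>) xs x sequentially \<longleftrightarrow>
    bounded (range xs) \<and> limitin \<tau> xs x sequentially"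
proof -
  have co: "coarser_topology \<tau> euclidean" using adm by (simp add: bicontinuous_admissible_def)
  have "bounded (range (\<lambda>n. ys n + y))" if "bounded (range ys)" for ys :: "nat \<Rightarrow> 'a" and y
    using bounded_translation[OF that, of y] by (simp add: image_image add.commute)
  from this[of xs "- x"] this[of "\<lambda>n. xs n - x" x]
  have bnd: "bounded (range (\<lambda>n. xs n - x)) \<longleftrightarrow> bounded (range xs)" by auto
  have lim: "limitin \<tau> (\<lambda>n. xs n - x) 0 sequentially \<longleftrightarrow> limitin \<tau> xs x sequentially"
    by (simp add: limitin_iff_disc_nhd[OF lct])
  have mix: "limitin (mixed_topology \<tau>) xs x sequentially \<longleftrightarrow>
    (\<forall>C\<in>mixed_discs \<tau>. \<forall>\<^sub>F n in sequentially. xs n - x \<in> C)"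
    by (auto simp: limitin_iff_disc_nhd[OF locally_convex_mixed_topology[OF lct co]]
        disc_nhd_mixed_iff[OF lct co])
  show ?thesis
  proof
    assume L: "limitin (mixed_topology \<tau>) xs x sequentially"
    then have "bounded (range (\<lambda>n. xs n - x))"
      using mix by (intro mixed_null_imp_bounded[OF lct adm]) auto
    moreover have "limitin \<tau> xs x sequentially"
      by (rule coarser_limitin[OF coarser_mixed_topology[OF lct co] L lct_topspace[OF lct]])
    ultimately show "bounded (range xs) \<and> limitin \<tau> xs x sequentially" using bnd by blast
  next
    assume "bounded (range xs) \<and> limitin \<tau> xs x sequentially"
    then have "bounded_null_seq \<tau> (\<lambda>n. xs n - x)" using bnd lim by (simp add: bounded_null_seq_def)
    then show "limitin (mixed_topology \<tau>) xs x sequentially"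
      unfolding mix by (auto simp: mixed_discs_def)
  qed
qed

text \<open>
  A mixed Cauchy sequence is bounded, since otherwise differences \<open>xs (m n) - xs n\<close> with \<open>m n \<ge> n\<close>
  would form an unbounded mixed null sequence. Being also \<open>\<tau>\<close>-Cauchy, it has a \<open>\<tau>\<close>-limit by
  completeness of \<open>\<tau>\<close> on bounded sets, and this limit is a mixed one.
\<close>

lemma sequentially_complete_mixed:
  assumes lct: "locally_convex_topology \<tau>" and adm: "bicontinuous_admissible \<tau>"
  shows "sequentially_complete (mixed_topology \<tau>)"
  unfolding sequentially_complete_def
proof (intro allI impI)
  have co: "coarser_topology \<tau> euclidean" using adm by (simp add: bicontinuous_admissible_def)
  fix xs assume Ca: "Cauchy_seq_in (mixed_topology \<tau>) xs"
  have Cauchy: "\<exists>N. \<forall>m\<ge>N. \<forall>n\<ge>N. xs m - xs n \<in> C" if "C \<in> mixed_discs \<tau>" for C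
    using Ca that by (simp add: Cauchy_seq_in_iff_disc_nhd[OF locally_convex_mixed_topology[OF lct co]]
        disc_nhd_mixed_iff[OF lct co])
  have bnd: "bounded (range xs)"
  proof (rule ccontr)
    assume unb: "\<not> bounded (range xs)"
    have "\<exists>m\<ge>n. norm (xs m - xs n) > real n" for n
    proof (rule ccontr)
      assume "\<not> ?thesis"
      then have "xs ` {n..} \<subseteq> cball (xs n) (real n)"
        by (auto simp: not_less dist_norm norm_minus_commute)
      then show False using unb bounded_range_of_tail bounded_subset[OF bounded_cball] by blast
    qed
    then obtain m where m: "\<And>n. m n \<ge> n" "\<And>n. norm (xs (m n) - xs n) > real n" by metis
    have "bounded (range (\<lambda>n. xs (m n) - xs n))"
    proof (rule mixed_null_imp_bounded[OF lct adm])
      fix C assume "C \<in> mixed_discs \<tau>"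
      then obtain N where N: "\<And>m n. m \<ge> N \<Longrightarrow> n \<ge> N \<Longrightarrow> xs m - xs n \<in> C" using Cauchy by blast
      have "xs (m n) - xs n \<in> C" if "n \<ge> N" for n using N[of "m n" n] m(1)[of n] that by simp
      then show "\<forall>\<^sub>F n in sequentially. xs (m n) - xs n \<in> C" by (auto simp: eventually_sequentially)
    qed
    then obtain K where "\<And>n. norm (xs (m n) - xs n) \<le> K" by (auto simp: bounded_iff)
    then show False using m(2) real_arch_simple[of K] by (metis not_less order_trans)
  qed
  moreover have "Cauchy_seq_in \<tau> xs"
    using Ca coarser_mixed_topology[OF lct co] by (auto simp: Cauchy_seq_in_def coarser_topology_def)
  ultimately obtain x where "limitin \<tau> xs x sequentially"
    using adm by (auto simp: bicontinuous_admissible_def sequentially_complete_on_bounded_def convergent_seq_in_def)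
  then show "convergent_seq_in (mixed_topology \<tau>) xs"
    using bnd limitin_mixed_iff[OF lct adm] by (auto simp: convergent_seq_in_def)
qed

section \<open>Riemann integration in locally convex spaces\<close>

text \<open>
  The content of an interval is additive over the traces on it of any tagged division. This is the
  additivity of the integral of the indicator function of \<open>k\<close>, which avoids dealing with the
  degenerate or overlapping traces one by one.
\<close>

lemma sum_content_Int:
  fixes a b :: real
  assumes p: "p tagged_division_of {a..b}" and kl: "k \<subseteq> {a..b}" "k = {c..d}"
  shows "(\<Sum>(y, l)\<in>p. measure lborel (k \<inter> l)) = measure lborel k"
proof -
  have *: "((\<lambda>t. if t \<in> k then 1 else (0::real)) has_integral measure lborel (k \<inter> l)) l"
    if "l = {u..v}" for l u v
  proof -
    have "k \<inter> l = {max c u..min d v}" using that kl by auto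
    then have "((\<lambda>_. 1::real) has_integral measure lborel (k \<inter> l)) (k \<inter> l)"
      using has_integral_const_real[of "1::real" "max c u" "min d v"] by simp
    then show ?thesis by (subst has_integral_restrict_Int) (simp add: Int_commute)
  qed
  have "{a..b} = cbox a b" by simp
  then have p': "p tagged_division_of cbox a b" using p by simp
  have whole: "((\<lambda>t. if t \<in> k then 1 else (0::real)) has_integral measure lborel k) {a..b}"
    using *[OF refl, of a b] kl(1) by (simp only: Int_absorb2)
  have "integral {a..b} (\<lambda>t. if t \<in> k then 1 else (0::real))
      = (\<Sum>(y, l)\<in>p. integral l (\<lambda>t. if t \<in> k then 1 else 0))"
    using integral_combine_tagged_division_topdown[OF _ p', of "\<lambda>t. if t \<in> k then 1 else (0::real)"]
      whole by (auto simp: integrable_on_def)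
  also have "\<dots> = (\<Sum>(y, l)\<in>p. measure lborel (k \<inter> l))"
  proof (rule sum.cong[OF refl], clarify)
    fix y l assume "(y, l) \<in> p"
    then obtain u v where "l = {u..v}" using tagged_division_ofD(4)[OF p] by (metis box_real(2))
    from integral_unique[OF *[OF this]]
    show "integral l (\<lambda>t. if t \<in> k then 1 else 0) = measure lborel (k \<inter> l)" .
  qed
  finally show ?thesis using integral_unique[OF whole] by simp
qed

lemma tagged_division_interval:
  fixes a b :: real
  assumes "p tagged_division_of {a..b}" "(x, k) \<in> p"
  obtains c d where "k = {c..d}" "c \<le> x" "x \<le> d" "k \<subseteq> {a..b}" "measure lborel k = d - c"
proof -
  obtain c d where cd: "k = {c..d}" using tagged_division_ofD(4)[OF assms] by (metis box_real(2))
  have "x \<in> k" "k \<subseteq> {a..b}" using tagged_division_ofD(2,3)[OF assms] by auto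
  with cd show ?thesis by (intro that[of c d]) auto
qed

lemma sum_content_tagged_division:
  fixes a b :: real
  assumes "p tagged_division_of {a..b}" "a \<le> b"
  shows "(\<Sum>(x, k)\<in>p. measure lborel k) = b - a"
  using additive_content_tagged_division[of p a b] assms by simp

text \<open>
  Common refinement: by \<open>sum_content_Int\<close> both sums can be written over all pairs of pieces
  \<open>k\<close>, \<open>l\<close> with weight the content of \<open>k \<inter> l\<close>. Pieces that meet have tags less than \<open>2 * \<delta>\<close> apart, and
  the weights add up to \<open>b - a\<close>, so the difference is a convex combination of elements of \<open>C\<close> if \<open>a < b\<close>.
\<close>

lemma Riemann_sum_diff_in:
  fixes f :: "real \<Rightarrow> 'a::real_vector"
  assumes C: "abs_convex C" and ab: "a \<le> b"
    and near: "\<And>s t. s \<in> {a..b} \<Longrightarrow> t \<in> {a..b} \<Longrightarrow> \<bar>s - t\<bar> < 2 * \<delta> \<Longrightarrow> (b - a) *\<^sub>R (f s - f t) \<in> C"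
    and p: "p tagged_division_of {a..b}" "\<forall>(x, k)\<in>p. measure lborel k < \<delta>"
    and q: "q tagged_division_of {a..b}" "\<forall>(x, k)\<in>q. measure lborel k < \<delta>"
  shows "(\<Sum>(x, k)\<in>p. measure lborel k *\<^sub>R f x) - (\<Sum>(x, k)\<in>q. measure lborel k *\<^sub>R f x) \<in> C"
proof (cases "a = b")
  case True
  have "measure lborel k = 0" if "(x, k) \<in> r" "r tagged_division_of {a..b}" for x k r
    using tagged_division_interval[OF that(2,1)] True by (metis atLeastAtMost_singleton content_real_eq_0 measure_lborel_singleton subset_singletonD content_empty)
  then have "(\<Sum>(x, k)\<in>r. measure lborel k *\<^sub>R f x) = 0" if "r tagged_division_of {a..b}" for r
    using that by (intro sum.neutral) auto
  then show ?thesis using p q C by (simp add: abs_convex_def)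
next
  case False
  then have L: "b - a > 0" using ab by simp
  let ?w = "\<lambda>((x, k), (y, l)). measure lborel (k \<inter> l)"
  \<comment> \<open>Disjoint pieces have weight \<open>0\<close> but possibly distant tags; replacing their term by \<open>0\<close> keeps
    every term in \<open>C\<close>.\<close>
  define v where "v = (\<lambda>((x::real, k::real set), (y::real, l::real set)).
      if k \<inter> l = {} then 0 else (b - a) *\<^sub>R (f x - f y))"
  have fin: "finite p" "finite q" using p q by auto
  have P: "(\<Sum>(x, k)\<in>p. measure lborel k *\<^sub>R f x) = (\<Sum>(x, k)\<in>p. \<Sum>(y, l)\<in>q. measure lborel (k \<inter> l) *\<^sub>R f x)"
  proof (rule sum.cong[OF refl], clarify)
    fix x k assume "(x, k) \<in> p"
    then obtain c d where "k = {c..d}" "k \<subseteq> {a..b}" using tagged_division_interval[OF p(1)] by metis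
    from sum_content_Int[OF q(1) this(2,1)]
    show "measure lborel k *\<^sub>R f x = (\<Sum>(y, l)\<in>q. measure lborel (k \<inter> l) *\<^sub>R f x)"
      by (simp add: scaleR_sum_left[symmetric] case_prod_unfold)
  qed
  have Q: "(\<Sum>(y, l)\<in>q. measure lborel l *\<^sub>R f y) = (\<Sum>(y, l)\<in>q. \<Sum>(x, k)\<in>p. measure lborel (k \<inter> l) *\<^sub>R f y)"
  proof (rule sum.cong[OF refl], clarify)
    fix y l assume "(y, l) \<in> q"
    then obtain c d where "l = {c..d}" "l \<subseteq> {a..b}" using tagged_division_interval[OF q(1)] by metis
    from sum_content_Int[OF p(1) this(2,1)]
    show "measure lborel l *\<^sub>R f y = (\<Sum>(x, k)\<in>p. measure lborel (k \<inter> l) *\<^sub>R f y)"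
      by (simp add: scaleR_sum_left[symmetric] case_prod_unfold Int_commute)
  qed
  have "(\<Sum>(x, k)\<in>p. measure lborel k *\<^sub>R f x) - (\<Sum>(y, l)\<in>q. measure lborel l *\<^sub>R f y)
      = (\<Sum>(x, k)\<in>p. \<Sum>(y, l)\<in>q. measure lborel (k \<inter> l) *\<^sub>R (f x - f y))"
    unfolding P Q
    by (simp add: case_prod_unfold sum_subtractf scaleR_diff_right
        sum.swap[of "\<lambda>z z'. measure lborel (snd z' \<inter> snd z) *\<^sub>R f (fst z)" p q])
  also have "\<dots> = (\<Sum>z\<in>p \<times> q. ?w z *\<^sub>R (case z of ((x, k), (y, l)) \<Rightarrow> f x - f y))"
    by (simp add: sum.cartesian_product case_prod_unfold)
  also have "\<dots> = (\<Sum>z\<in>p \<times> q. (?w z / (b - a)) *\<^sub>R v z)"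
    using L by (intro sum.cong) (auto simp: v_def)
  also have "\<dots> \<in> C"
  proof (rule abs_convex_sum[OF C])
    show "finite (p \<times> q)" using fin by simp
    show "0 \<le> ?w z / (b - a)" for z using L by (auto simp: case_prod_unfold)
    have "(\<Sum>z\<in>p \<times> q. ?w z) = (\<Sum>(x, k)\<in>p. \<Sum>(y, l)\<in>q. measure lborel (k \<inter> l))"
      by (simp add: sum.cartesian_product case_prod_unfold)
    also have "\<dots> = (\<Sum>(x, k)\<in>p. measure lborel k)"
    proof (rule sum.cong[OF refl], clarify)
      fix x k assume "(x, k) \<in> p"
      then obtain c d where "k = {c..d}" "k \<subseteq> {a..b}" using tagged_division_interval[OF p(1)] by metis
      from sum_content_Int[OF q(1) this(2,1)]
      show "(\<Sum>(y, l)\<in>q. measure lborel (k \<inter> l)) = measure lborel k" .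
    qed
    also have "\<dots> = b - a" using sum_content_tagged_division[OF p(1) ab] .
    finally show "(\<Sum>z\<in>p \<times> q. ?w z / (b - a)) \<le> 1"
      using L by (simp add: sum_divide_distrib[symmetric])
    fix z assume "z \<in> p \<times> q"
    then obtain x k y l where z: "z = ((x, k), (y, l))" "(x, k) \<in> p" "(y, l) \<in> q" by auto
    obtain c d where k: "k = {c..d}" "c \<le> x" "x \<le> d" "k \<subseteq> {a..b}" "measure lborel k = d - c"
      using tagged_division_interval[OF p(1) z(2)] by metis
    obtain c' d' where l: "l = {c'..d'}" "c' \<le> y" "y \<le> d'" "l \<subseteq> {a..b}" "measure lborel l = d' - c'"
      using tagged_division_interval[OF q(1) z(3)] by metis
    have len: "d - c < \<delta>" "d' - c' < \<delta>" using p(2) q(2) z k l by auto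
    show "v z \<in> C"
    proof (cases "k \<inter> l = {}")
      case True
      then show ?thesis using C z by (simp add: v_def abs_convex_def)
    next
      case False
      then obtain t where "t \<in> k" "t \<in> l" by blast
      then have "c \<le> t" "t \<le> d" "c' \<le> t" "t \<le> d'" using k(1) l(1) by auto
      then have "\<bar>x - y\<bar> < 2 * \<delta>" using k l len by linarith
      moreover have "x \<in> {a..b}" "y \<in> {a..b}" using k l by auto
      ultimately show ?thesis using near[of x y] False z by (simp add: v_def)
    qed
  qed
  finally show ?thesis .
qed

text \<open>
  A constant gauge controls the mesh. It serves twice: for the existence of divisions with small mesh,
  and for comparing the Riemann integral with the gauge integral.
\<close>

lemma fine_ball_imp_mesh:
  fixes a b :: real
  assumes p: "p tagged_division_of {a..b}" "(\<lambda>x. ball x (\<delta> / 3)) fine p"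
    and xk: "(x, k) \<in> p" and \<delta>: "\<delta> > 0"
  shows "measure lborel k < \<delta>"
proof -
  obtain c d where k: "k = {c..d}" "c \<le> x" "x \<le> d" "measure lborel k = d - c"
    using tagged_division_interval[OF p(1) xk] by metis
  have "k \<subseteq> ball x (\<delta> / 3)" using p(2) xk by (auto simp: fine_def)
  moreover have "c \<in> k" "d \<in> k" using k by auto
  ultimately have "c \<in> ball x (\<delta> / 3)" "d \<in> ball x (\<delta> / 3)" by auto
  then show ?thesis using k \<delta> by (simp add: dist_real_def)
qed

lemma exists_fine_tagged_division:
  fixes a b :: real
  assumes "\<delta> > 0"
  obtains p where "p tagged_division_of {a..b}" "\<forall>(x, k)\<in>p. measure lborel k < \<delta>"
proof -
  have "gauge (\<lambda>x::real. ball x (\<delta> / 3))" using assms by (intro gauge_ball) auto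
  then obtain p where p: "p tagged_division_of cbox a b" "(\<lambda>x. ball x (\<delta> / 3)) fine p"
    by (rule fine_division_exists)
  then have "measure lborel k < \<delta>" if "(x, k) \<in> p" for x k
    using fine_ball_imp_mesh[of p a b \<delta> x k] that assms by simp
  then show ?thesis using p(1) that by (metis (no_types, lifting) box_real(2) case_prodI2)
qed

text \<open>
  Only sequential completeness is available, so the integral is taken as the limit of the sums along
  one sequence of divisions with mesh tending to zero; all other divisions of small mesh are compared
  with a late member of that sequence.
\<close>

lemma Riemann_integrable_of_uniformly_continuous:
  fixes f :: "real \<Rightarrow> 'a::real_vector"
  assumes Z: "locally_convex_topology Z" "sequentially_complete Z" and ab: "a \<le> b"
    and uc: "\<And>C. disc_nhd Z C \<Longrightarrow>
      \<exists>\<delta>>0. \<forall>s\<in>{a..b}. \<forall>t\<in>{a..b}. \<bar>s - t\<bar> < \<delta> \<longrightarrow> f s - f t \<in> C"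
  shows "\<exists>v. has_Riemann_integral_in Z f v a b"
proof -
  let ?S = "\<lambda>p. \<Sum>(x, k)\<in>p. measure lborel k *\<^sub>R f x"
  let ?fine = "\<lambda>\<delta> p. p tagged_division_of {a..b} \<and> (\<forall>(x, k)\<in>p. measure lborel k < \<delta>)"
  have close: "\<exists>\<delta>>0. \<forall>p q. ?fine \<delta> p \<longrightarrow> ?fine \<delta> q \<longrightarrow> ?S p - ?S q \<in> C" if C: "disc_nhd Z C" for C
  proof -
    obtain \<delta> where \<delta>: "\<delta> > 0" "\<forall>s\<in>{a..b}. \<forall>t\<in>{a..b}. \<bar>s - t\<bar> < \<delta> \<longrightarrow> (b - a) *\<^sub>R (f s - f t) \<in> C"
      using uc[OF disc_nhd_scale[OF Z(1) C, of "b - a"]] by auto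
    have "?S p - ?S q \<in> C" if "?fine (\<delta> / 2) p" "?fine (\<delta> / 2) q" for p q
      using Riemann_sum_diff_in[of C a b "\<delta> / 2" f p q] C ab \<delta>(2) that by (simp add: disc_nhd_def)
    then show ?thesis using \<delta>(1) by (intro exI[of _ "\<delta> / 2"]) simp
  qed
  have "\<exists>p. ?fine (1 / real (Suc n)) p" for n
    using exists_fine_tagged_division[of "1 / real (Suc n)" a b] by (metis of_nat_0_less_iff zero_less_Suc zero_less_divide_1_iff)
  then obtain P where P: "\<And>n. ?fine (1 / real (Suc n)) (P n)" by metis
  have P': "\<exists>N. \<forall>n\<ge>N. ?fine \<delta> (P n)" if \<delta>: "\<delta> > 0" for \<delta>
  proof -
    obtain N where N: "1 / real (Suc N) < \<delta>" using nat_approx_posE[OF \<delta>] by auto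
    have "?fine \<delta> (P n)" if "n \<ge> N" for n
    proof -
      have "1 / real (Suc n) \<le> 1 / real (Suc N)" using that by (simp add: frac_le)
      then have "1 / real (Suc n) < \<delta>" using N by simp
      then show ?thesis using P[of n] by fastforce
    qed
    then show ?thesis by blast
  qed
  have "Cauchy_seq_in Z (\<lambda>n. ?S (P n))"
    unfolding Cauchy_seq_in_iff_disc_nhd[OF Z(1)]
  proof (intro allI impI)
    fix C assume "disc_nhd Z C"
    then obtain \<delta> where \<delta>: "\<delta> > 0" "\<And>p q. ?fine \<delta> p \<Longrightarrow> ?fine \<delta> q \<Longrightarrow> ?S p - ?S q \<in> C"
      using close by meson
    then show "\<exists>N. \<forall>m\<ge>N. \<forall>n\<ge>N. ?S (P m) - ?S (P n) \<in> C" using P'[OF \<delta>(1)] by meson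
  qed
  then obtain v where v: "limitin Z (\<lambda>n. ?S (P n)) v sequentially"
    using Z(2) by (auto simp: sequentially_complete_def convergent_seq_in_def)
  have "has_Riemann_integral_in Z f v a b"
    unfolding has_Riemann_integral_in_iff_disc_nhd[OF Z(1)]
  proof (intro allI impI)
    fix C assume C: "disc_nhd Z C"
    let ?C = "{x. 2 *\<^sub>R x \<in> C}"
    have C2: "disc_nhd Z ?C" using disc_nhd_scale[OF Z(1) C] .
    then obtain \<delta> where \<delta>: "\<delta> > 0" "\<And>p q. ?fine \<delta> p \<Longrightarrow> ?fine \<delta> q \<Longrightarrow> ?S p - ?S q \<in> ?C"
      using close by meson
    obtain N where N: "\<And>n. n \<ge> N \<Longrightarrow> ?fine \<delta> (P n)" using P'[OF \<delta>(1)] by meson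
    have "\<forall>\<^sub>F n in sequentially. ?S (P n) - v \<in> ?C"
      using v C2 unfolding limitin_iff_disc_nhd[OF Z(1)] by blast
    then obtain N' where N': "\<And>n. n \<ge> N' \<Longrightarrow> ?S (P n) - v \<in> ?C"
      by (auto simp: eventually_sequentially)
    define n where "n = max N N'"
    have n: "?fine \<delta> (P n)" "?S (P n) - v \<in> ?C" using N[of n] N'[of n] by (auto simp: n_def)
    have "?S p - v \<in> C" if "?fine \<delta> p" for p
    proof -
      have "(?S p - ?S (P n)) + (?S (P n) - v) \<in> C"
        using \<delta>(2)[OF that n(1)] n(2) C by (intro abs_convex_midpoint) (auto simp: disc_nhd_def)
      then show ?thesis by simp
    qed
    then show "\<exists>\<delta>>0. \<forall>p. ?fine \<delta> p \<longrightarrow> ?S p - v \<in> C" using \<delta>(1) by blast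
  qed
  then show ?thesis by blast
qed

text \<open>
  Through continuous functionals the vector-valued integral is accessible to scalar integration
  theory.
\<close>

lemma has_integral_functional_of_Riemann:
  assumes Z: "locally_convex_topology Z" and \<gamma>: "\<gamma> \<in> topological_dual Z"
    and v: "has_Riemann_integral_in Z f v a b"
  shows "((\<lambda>t. \<gamma> (f t)) has_integral \<gamma> v) {a..b}"
proof -
  have lin: "linear \<gamma>" and cont: "continuous_map Z euclideanreal \<gamma>"
    using \<gamma> by (auto simp: topological_dual_def)
  have "((\<lambda>t. \<gamma> (f t)) has_integral \<gamma> v) (cbox a b)"
    unfolding has_integral
  proof (intro allI impI)
    fix e :: real assume e: "e > 0"
    let ?U = "{x. \<gamma> x \<in> ball 0 e}"
    have "openin Z ?U"
      using openin_continuous_map_preimage[OF cont, of "ball 0 e"] lct_topspace[OF Z] by simp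
    moreover have "0 \<in> ?U" using e lin by (simp add: linear_0)
    ultimately obtain \<delta> where \<delta>: "\<delta> > 0"
      "\<And>p. p tagged_division_of {a..b} \<Longrightarrow> \<forall>(x, k)\<in>p. measure lborel k < \<delta> \<Longrightarrow>
         (\<Sum>(x, k)\<in>p. measure lborel k *\<^sub>R f x) - v \<in> ?U"
      using v unfolding has_Riemann_integral_in_def by meson
    show "\<exists>\<delta>. gauge \<delta> \<and> (\<forall>p. p tagged_division_of cbox a b \<and> \<delta> fine p \<longrightarrow>
        norm ((\<Sum>(x, k)\<in>p. measure lborel k *\<^sub>R \<gamma> (f x)) - \<gamma> v) < e)"
    proof (intro exI[of _ "\<lambda>x. ball x (\<delta> / 3)"] conjI allI impI)
      show "gauge (\<lambda>x::real. ball x (\<delta> / 3))" using \<delta>(1) by (intro gauge_ball) auto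
    next
      fix p assume p: "p tagged_division_of cbox a b \<and> (\<lambda>x. ball x (\<delta> / 3)) fine p"
      have "measure lborel k < \<delta>" if "(x, k) \<in> p" for x k
        using fine_ball_imp_mesh[of p a b \<delta> x k] that p \<delta>(1) by simp
      then have "(\<Sum>(x, k)\<in>p. measure lborel k *\<^sub>R f x) - v \<in> ?U"
        using \<delta>(2)[of p] p by auto
      moreover have "\<gamma> ((\<Sum>(x, k)\<in>p. measure lborel k *\<^sub>R f x) - v)
          = (\<Sum>(x, k)\<in>p. measure lborel k *\<^sub>R \<gamma> (f x)) - \<gamma> v"
        using lin by (simp add: linear_diff linear_sum linear_scale case_prod_unfold)
      ultimately show "norm ((\<Sum>(x, k)\<in>p. measure lborel k *\<^sub>R \<gamma> (f x)) - \<gamma> v) < e"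
        by (simp add: dist_norm)
    qed
  qed
  then show ?thesis by simp
qed

section \<open>Integrals of exponentially decaying functions\<close>

lemma bicontinuous_admissibleD:
  assumes "bicontinuous_admissible \<tau>"
  shows "coarser_topology \<tau> euclidean" "norming (blinfun_apply -` topological_dual \<tau>)"
  using assms by (auto simp: bicontinuous_admissible_def)

lemma mixed_limit_of_continuous:
  fixes f :: "real \<Rightarrow> 'a::real_normed_vector"
  assumes lct: "locally_convex_topology \<tau>" and adm: "bicontinuous_admissible \<tau>"
    and f: "continuous_map (top_of_set S) \<tau> f" "bounded (f ` S)"
    and t: "\<And>n. t n \<in> S" "t \<longlonglongrightarrow> l" "l \<in> S"
  shows "limitin (mixed_topology \<tau>) (\<lambda>n. f (t n)) (f l) sequentially"
proof -
  have "limitin (top_of_set S) t l sequentially"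
    using t by (simp add: limitin_subtopology)
  from continuous_map_limit[OF f(1) this]
  have "limitin \<tau> (\<lambda>n. f (t n)) (f l) sequentially" by (simp add: o_def)
  moreover have "bounded (range (\<lambda>n. f (t n)))"
    using f(2) by (rule bounded_subset) (use t in auto)
  ultimately show ?thesis by (simp add: limitin_mixed_iff[OF lct adm])
qed

text \<open>
  The usual compactness proof, carried out with sequences because mixed limits are understood only for
  sequences: pairs \<open>s n\<close>, \<open>t n\<close> violating the claim would have subsequences with a common limit \<open>l\<close>.
\<close>

lemma mixed_uniformly_continuous:
  fixes f :: "real \<Rightarrow> 'a::real_normed_vector"
  assumes lct: "locally_convex_topology \<tau>" and adm: "bicontinuous_admissible \<tau>"
    and f: "continuous_map (top_of_set S) \<tau> f" "bounded (f ` S)" and S: "compact S"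
    and C: "disc_nhd (mixed_topology \<tau>) C"
  shows "\<exists>\<delta>>0. \<forall>s\<in>S. \<forall>t\<in>S. \<bar>s - t\<bar> < \<delta> \<longrightarrow> f s - f t \<in> C"
proof (rule ccontr)
  note lctm = locally_convex_mixed_topology[OF lct bicontinuous_admissibleD(1)[OF adm]]
  assume no: "\<not> ?thesis"
  have "\<exists>s t. s \<in> S \<and> t \<in> S \<and> \<bar>s - t\<bar> < 1 / real (Suc n) \<and> f s - f t \<notin> C" for n
    using no by (meson of_nat_0_less_iff zero_less_Suc zero_less_divide_1_iff)
  then obtain s t where st: "\<And>n. s n \<in> S" "\<And>n. t n \<in> S"
    "\<And>n. \<bar>s n - t n\<bar> < 1 / real (Suc n)" "\<And>n. f (s n) - f (t n) \<notin> C" by metis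
  obtain l r where l: "l \<in> S" "strict_mono (r :: nat \<Rightarrow> nat)" "(s \<circ> r) \<longlonglongrightarrow> l"
    using S st(1) unfolding compact_def by blast
  have "(\<lambda>n. s n - t n) \<longlonglongrightarrow> 0"
    by (rule Lim_null_comparison[OF _ LIMSEQ_Suc[OF lim_1_over_n]])
      (use st(3) in \<open>auto intro!: always_eventually less_imp_le\<close>)
  from LIMSEQ_subseq_LIMSEQ[OF this l(2)]
  have "(\<lambda>n. (s \<circ> r) n - t (r n)) \<longlonglongrightarrow> 0" by (simp add: o_def)
  from tendsto_diff[OF l(3) this] have "(\<lambda>n. t (r n)) \<longlonglongrightarrow> l" by simp
  moreover have "(\<lambda>n. s (r n)) \<longlonglongrightarrow> l" using l(3) by (simp add: o_def)
  ultimately have lim: "limitin (mixed_topology \<tau>) (\<lambda>n. f (s (r n))) (f l) sequentially"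
    "limitin (mixed_topology \<tau>) (\<lambda>n. f (t (r n))) (f l) sequentially"
    using st l by (auto intro!: mixed_limit_of_continuous[OF lct adm f])
  let ?C = "{x. 2 *\<^sub>R x \<in> C}"
  have C2: "disc_nhd (mixed_topology \<tau>) ?C" using disc_nhd_scale[OF lctm C] .
  have "\<forall>\<^sub>F n in sequentially. f (s (r n)) - f l \<in> ?C \<and> f (t (r n)) - f l \<in> ?C"
    using lim[unfolded limitin_iff_disc_nhd[OF lctm], rule_format, OF C2] by (rule eventually_conj)
  then obtain n where n: "f (s (r n)) - f l \<in> ?C" "f (t (r n)) - f l \<in> ?C"
    by (auto simp: eventually_sequentially)
  have ac: "abs_convex C" using C by (simp add: disc_nhd_def)
  then have "- (2 *\<^sub>R (f (t (r n)) - f l)) \<in> C" using n(2) by (simp add: abs_convex_def)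
  then have "2 *\<^sub>R (f l - f (t (r n))) \<in> C" by (simp add: scaleR_diff_right)
  then have "(f (s (r n)) - f l) + (f l - f (t (r n))) \<in> C"
    using n(1) by (intro abs_convex_midpoint ac) auto
  then show False using st(4)[of "r n"] by simp
qed

lemma exp_decay_at_top:
  fixes c :: real
  assumes "c < 0"
  shows "((\<lambda>t. exp (c * t)) \<longlongrightarrow> 0) at_top"
proof -
  have "filterlim (\<lambda>t. c * t) at_bot at_top"
    using assms by (intro filterlim_tendsto_neg_mult_at_bot[OF tendsto_const]) (auto intro: filterlim_ident)
  then show ?thesis by (rule filterlim_compose[OF exp_at_bot])
qed

lemma integral_exp_le:
  fixes g :: "real \<Rightarrow> real"
  assumes c: "c > 0" and ab: "a \<le> b" and g: "(g has_integral I) {a..b}"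
    and bound: "\<And>t. t \<in> {a..b} \<Longrightarrow> \<bar>g t\<bar> \<le> K * exp (- c * t)" and K: "K \<ge> 0"
  shows "\<bar>I\<bar> \<le> K / c * exp (- c * a)"
proof -
  have F: "((\<lambda>t. K * exp (- c * t)) has_integral (- K / c * exp (- c * b)) - (- K / c * exp (- c * a))) {a..b}"
    by (rule fundamental_theorem_of_calculus[OF ab])
      (use c in \<open>auto intro!: derivative_eq_intros simp flip: has_real_derivative_iff_has_vector_derivative\<close>)
  have "norm (integral {a..b} g) \<le> integral {a..b} (\<lambda>t. K * exp (- c * t))"
    by (rule integral_norm_bound_integral) (use g F bound in \<open>auto simp: integrable_on_def\<close>)
  then have "\<bar>I\<bar> \<le> (- K / c * exp (- c * b)) - (- K / c * exp (- c * a))"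
    using integral_unique[OF g] integral_unique[OF F] by simp
  moreover have "K / c * exp (- c * b) \<ge> 0" using c K by simp
  ultimately show ?thesis by simp
qed

text \<open>
  On compact intervals the integral \<open>J a\<close> exists by uniform continuity. For \<open>0 \<le> a \<le> b\<close>, every
  \<open>\<tau>\<close>-continuous \<open>\<gamma>\<close> of norm at most one maps \<open>J b - J a\<close> to a scalar integral over \<open>{a..b}\<close>, which the
  decay of \<open>f\<close> bounds by \<open>K / c * exp (- c * a)\<close>. Since these \<open>\<gamma>\<close> are norming, the bound holds for the norm. Thus
  \<open>J\<close> converges even in norm.
\<close>

lemma mixed_generalized_Riemann_integrable:
  fixes f :: "real \<Rightarrow> 'a::banach"
  assumes lct: "locally_convex_topology \<tau>" and adm: "bicontinuous_admissible \<tau>"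
    and f: "continuous_map (top_of_set {0..}) \<tau> f"
    and bound: "\<And>t. t \<ge> 0 \<Longrightarrow> norm (f t) \<le> K * exp (- c * t)" and c: "c > 0"
  shows "generalized_Riemann_integrable_in (mixed_topology \<tau>) f"
proof -
  let ?Z = "mixed_topology \<tau>"
  note co = bicontinuous_admissibleD(1)[OF adm]
  note lctm = locally_convex_mixed_topology[OF lct co]
  have K: "K \<ge> 0" using bound[of 0] norm_ge_zero[of "f 0"] by (simp del: norm_ge_zero)
  have "\<exists>v. has_Riemann_integral_in ?Z f v 0 a" if a: "a \<ge> 0" for a
  proof (rule Riemann_integrable_of_uniformly_continuous[OF lctm sequentially_complete_mixed[OF lct adm] a])
    fix C assume C: "disc_nhd ?Z C"
    have cont: "continuous_map (top_of_set {0..a}) \<tau> f"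
      using continuous_map_from_subtopology_mono[OF f, of "{0..a}"] by auto
    have "norm (f t) \<le> K" if "t \<in> {0..a}" for t
    proof -
      have "K * exp (- c * t) \<le> K * 1" using that c K by (intro mult_left_mono) auto
      then show ?thesis using bound[of t] that by simp
    qed
    then have "bounded (f ` {0..a})" by (intro boundedI[of _ K]) auto
    from mixed_uniformly_continuous[OF lct adm cont this compact_Icc C]
    show "\<exists>\<delta>>0. \<forall>s\<in>{0..a}. \<forall>t\<in>{0..a}. \<bar>s - t\<bar> < \<delta> \<longrightarrow> f s - f t \<in> C" .
  qed
  then obtain J where J: "\<And>a. a \<ge> 0 \<Longrightarrow> has_Riemann_integral_in ?Z f (J a) 0 a" by metis
  define tail where "tail = (\<lambda>a. K / c * exp (- c * a))"
  have diff: "norm (J b - J a) \<le> tail a" if ab: "0 \<le> a" "a \<le> b" for a b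
  proof (rule norming_le[OF bicontinuous_admissibleD(2)[OF adm]])
    fix \<gamma> :: "'a \<Rightarrow>\<^sub>L real"
    assume "\<gamma> \<in> blinfun_apply -` topological_dual \<tau>" and n1: "norm \<gamma> \<le> 1"
    then have "blinfun_apply \<gamma> \<in> topological_dual ?Z"
      using coarser_mixed_topology[OF lct co] lct_topspace[OF lct] lct_topspace[OF lctm]
      by (auto simp: topological_dual_def continuous_map_def coarser_topology_def)
    note I = has_integral_functional_of_Riemann[OF lctm this J]
    let ?g = "\<lambda>t. blinfun_apply \<gamma> (f t)"
    have int: "?g integrable_on {0..b}" using I[of b] ab by (auto simp: integrable_on_def)
    then have "?g integrable_on {a..b}" by (rule integrable_on_subinterval) (use ab in auto)
    then obtain y where y: "(?g has_integral y) {a..b}" by (auto simp: integrable_on_def)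
    have "(?g has_integral blinfun_apply \<gamma> (J a) + y) {0..b}"
      using has_integral_combine[OF ab I[OF ab(1)] y] .
    then have "blinfun_apply \<gamma> (J b) = blinfun_apply \<gamma> (J a) + y"
      using I[of b] ab has_integral_unique by (metis order_trans)
    moreover have "\<bar>y\<bar> \<le> tail a" unfolding tail_def
    proof (rule integral_exp_le[OF c ab(2) y _ K])
      fix t assume "t \<in> {a..b}"
      then have t: "t \<ge> 0" using ab by simp
      have "\<bar>?g t\<bar> \<le> norm \<gamma> * norm (f t)" using norm_blinfun[of \<gamma> "f t"] by simp
      also have "\<dots> \<le> 1 * (K * exp (- c * t))" using n1 bound[OF t] by (intro mult_mono) auto
      finally show "\<bar>?g t\<bar> \<le> K * exp (- c * t)" by simp
    qed
    ultimately show "\<bar>blinfun_apply \<gamma> (J b - J a)\<bar> \<le> tail a" by (simp add: blinfun.diff_right)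
  qed
  have tail0: "(tail \<longlongrightarrow> 0) at_top"
  proof -
    have "((\<lambda>a. exp (- c * a)) \<longlongrightarrow> 0) at_top" using c by (intro exp_decay_at_top) simp
    from tendsto_mult_right_zero[OF this, of "K / c"] show ?thesis by (simp add: tail_def)
  qed
  have tailn: "(\<lambda>n. tail (real n)) \<longlonglongrightarrow> 0"
    by (rule filterlim_compose[OF tail0 filterlim_real_sequentially])
  have "Cauchy (\<lambda>n. J (real n))"
  proof (rule metric_CauchyI)
    fix e :: real assume "e > 0"
    then obtain N where N: "\<And>n. n \<ge> N \<Longrightarrow> tail (real n) < e"
      using order_tendstoD(2)[OF tailn] by (auto simp: eventually_sequentially)
    have less: "dist (J (real m)) (J (real n)) < e" if "N \<le> m" "m \<le> n" for m n
      using diff[of m n] N[of m] that by (simp add: dist_norm norm_minus_commute)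
    have "dist (J (real m)) (J (real n)) < e" if "m \<ge> N" "n \<ge> N" for m n
      using less[of m n] less[of n m] that by (cases "m \<le> n") (auto simp: dist_commute)
    then show "\<exists>M. \<forall>m\<ge>M. \<forall>n\<ge>M. dist (J (real m)) (J (real n)) < e" by blast
  qed
  then obtain v where v: "(\<lambda>n. J (real n)) \<longlonglongrightarrow> v" using Cauchy_convergent convergent_def by blast
  have "norm (J a - v) \<le> tail a" if a: "a \<ge> 0" for a
  proof (rule tendsto_upperbound[OF tendsto_norm[OF tendsto_diff[OF tendsto_const v]]])
    obtain N where N: "a \<le> real N" using real_arch_simple by blast
    have "norm (J a - J (real n)) \<le> tail a" if "n \<ge> N" for n
      using diff[of a "real n"] a N that by (simp add: norm_minus_commute)
    then show "\<forall>\<^sub>F n in sequentially. norm (J a - J (real n)) \<le> tail a"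
      by (auto simp: eventually_sequentially)
  qed simp
  then have "\<forall>\<^sub>F a in at_top. norm (J a - v) \<le> tail a"
    using eventually_ge_at_top[of 0] by (rule eventually_mono[rotated])
  then have "((\<lambda>a. J a - v) \<longlongrightarrow> 0) at_top" by (rule Lim_null_comparison[OF _ tail0])
  then have "(J \<longlongrightarrow> v) at_top" by (simp add: LIM_zero_iff)
  then have "limitin ?Z J v at_top"
    by (intro coarser_limitin[OF mixed_topology_coarser_norm[OF lct co]])
      (auto simp: lct_topspace[OF lctm])
  then show ?thesis using J unfolding generalized_Riemann_integrable_in_def by blast
qed

section \<open>Bi-continuous semigroups in the mixed topology\<close>

lemma bicontinuous_semigroup_norm_bound:
  assumes "bicontinuous_semigroup \<tau> \<alpha> T"
  obtains M where "M \<ge> 0" "\<And>t x. t \<ge> 0 \<Longrightarrow> norm (T t x) \<le> M * exp (\<alpha> * t) * norm x"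
proof -
  have "\<exists>M\<ge>0. \<forall>t\<ge>0. onorm (T t) \<le> M * exp (\<alpha> * t)"
    and bl: "\<And>t. t \<ge> 0 \<Longrightarrow> bounded_linear (T t)"
    using assms by (simp_all add: bicontinuous_semigroup_def)
  then obtain M where M: "M \<ge> 0" "\<And>t. t \<ge> 0 \<Longrightarrow> onorm (T t) \<le> M * exp (\<alpha> * t)" by auto
  have "norm (T t x) \<le> M * exp (\<alpha> * t) * norm x" if "t \<ge> 0" for t x
    using onorm[OF bl[OF that], of x] mult_right_mono[OF M(2)[OF that], of "norm x"] by simp
  then show ?thesis using M(1) that by blast
qed

lemma bicontinuous_semigroup_bounded_on:
  assumes T: "bicontinuous_semigroup \<tau> \<alpha> T"
  obtains K where "\<And>t x. t \<in> {0..R} \<Longrightarrow> norm (T t x) \<le> K * norm x" "K \<ge> 0"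
proof -
  obtain M where M: "M \<ge> 0" "\<And>t x. t \<ge> 0 \<Longrightarrow> norm (T t x) \<le> M * exp (\<alpha> * t) * norm x"
    using bicontinuous_semigroup_norm_bound[OF T] by blast
  have "norm (T t x) \<le> M * exp (\<bar>\<alpha>\<bar> * R) * norm x" if "t \<in> {0..R}" for t x
  proof -
    have "\<alpha> * t \<le> \<bar>\<alpha>\<bar> * R" using that by (intro mult_mono) auto
    then have "M * exp (\<alpha> * t) * norm x \<le> M * exp (\<bar>\<alpha>\<bar> * R) * norm x"
      using M(1) by (intro mult_right_mono mult_left_mono) auto
    then show ?thesis using M(2)[of t x] that by auto
  qed
  then show ?thesis using M(1) that[of "M * exp (\<bar>\<alpha>\<bar> * R)"] by simp
qed

text \<open>
  A failure of equicontinuity yields times \<open>t N\<close> and indices \<open>m N\<close> for which the vectors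
  \<open>T (t N) (zs (m N)) - T (t N) z\<close> avoid a mixed neighbourhood of zero. They form a bounded sequence, and
  the uniformity in time in the bi-continuity condition makes it \<open>\<tau>\<close>-null: a contradiction.
\<close>

lemma mixed_locally_equicontinuous:
  assumes lct: "locally_convex_topology \<tau>" and adm: "bicontinuous_admissible \<tau>"
    and T: "bicontinuous_semigroup \<tau> \<alpha> T" and R: "R > 0"
  shows "sequentially_equicontinuous (mixed_topology \<tau>) {0..R} T"
  unfolding sequentially_equicontinuous_iff_disc_nhd[OF
      locally_convex_mixed_topology[OF lct bicontinuous_admissibleD(1)[OF adm]]]
    disc_nhd_mixed_iff[OF lct bicontinuous_admissibleD(1)[OF adm]] limitin_mixed_iff[OF lct adm]
proof (intro allI impI, elim conjE, rule ccontr)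
  fix zs z C assume C: "C \<in> mixed_discs \<tau>" and z: "bounded (range zs)" "limitin \<tau> zs z sequentially"
    and no: "\<not> (\<exists>N. \<forall>t\<in>{0..R}. \<forall>n\<ge>N. T t (zs n) - T t z \<in> C)"
  have "\<exists>t n. t \<in> {0..R} \<and> n \<ge> N \<and> T t (zs n) - T t z \<notin> C" for N using no by blast
  then obtain t m where tm: "\<And>N. t N \<in> {0..R}" "\<And>N. m N \<ge> N"
      "\<And>N. T (t N) (zs (m N)) - T (t N) z \<notin> C" by metis
  define ys where "ys = (\<lambda>N. T (t N) (zs (m N)) - T (t N) z)"
  obtain K where K: "\<And>t x. t \<in> {0..R} \<Longrightarrow> norm (T t x) \<le> K * norm x" "K \<ge> 0"
    using bicontinuous_semigroup_bounded_on[OF T] by blast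
  obtain L where L: "\<And>n. norm (zs n) \<le> L" using z(1) by (auto simp: bounded_iff)
  have "norm (ys N) \<le> K * L + K * norm z" for N
  proof -
    have "norm (ys N) \<le> norm (T (t N) (zs (m N))) + norm (T (t N) z)"
      unfolding ys_def by (rule norm_triangle_ineq4)
    also have "\<dots> \<le> K * norm (zs (m N)) + K * norm z" using K(1) tm(1) by (intro add_mono) auto
    also have "\<dots> \<le> K * L + K * norm z" using L K(2) by (simp add: mult_left_mono)
    finally show ?thesis .
  qed
  then have "bounded (range ys)" by (auto simp: bounded_iff)
  moreover have "limitin \<tau> ys 0 sequentially"
    unfolding limitin_iff_disc_nhd[OF lct]
  proof (intro allI impI)
    fix D assume "disc_nhd \<tau> D"
    then obtain U where U: "openin \<tau> U" "0 \<in> U" "U \<subseteq> D" by (auto simp: disc_nhd_def)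
    have "\<And>xs x s U. bounded (range xs) \<Longrightarrow> limitin \<tau> xs x sequentially \<Longrightarrow> s > 0 \<Longrightarrow> openin \<tau> U \<Longrightarrow>
        0 \<in> U \<Longrightarrow> \<exists>N. \<forall>n\<ge>N. \<forall>t\<in>{0..s}. T t (xs n) - T t x \<in> U"
      using T by (simp add: bicontinuous_semigroup_def)
    from this[OF z R U(1,2)] obtain N
      where N: "\<And>n t. n \<ge> N \<Longrightarrow> t \<in> {0..R} \<Longrightarrow> T t (zs n) - T t z \<in> U" by blast
    have "ys n \<in> D" if "n \<ge> N" for n
      using N[of "m n" "t n"] tm(1,2)[of n] that U by (auto simp: ys_def)
    then show "\<forall>\<^sub>F n in sequentially. ys n - 0 \<in> D" by (auto simp: eventually_sequentially)
  qed
  ultimately have "\<forall>\<^sub>F n in sequentially. ys n \<in> C"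
    using C by (auto simp: mixed_discs_def bounded_null_seq_def)
  then show False using tm(3) by (simp add: ys_def)
qed

text \<open>
  A limit along \<open>at_right 0\<close> can be tested on sequences of times tending to zero; along them the orbit
  is bounded and \<open>\<tau>\<close>-convergent.
\<close>

lemma mixed_strongly_continuous:
  assumes lct: "locally_convex_topology \<tau>" and adm: "bicontinuous_admissible \<tau>"
    and T: "bicontinuous_semigroup \<tau> \<alpha> T"
  shows "limitin (mixed_topology \<tau>) (\<lambda>t. T t z) z (at_right 0)"
  unfolding limitin_iff_disc_nhd[OF
      locally_convex_mixed_topology[OF lct bicontinuous_admissibleD(1)[OF adm]]]
proof (intro allI impI, rule sequentially_imp_eventually_within, intro allI impI, elim conjE)
  fix C and t :: "nat \<Rightarrow> real"
  assume C: "disc_nhd (mixed_topology \<tau>) C" and t: "\<forall>n. t n \<in> {0<..} \<and> t n \<noteq> 0" "t \<longlonglongrightarrow> 0"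
  obtain R where R: "\<And>n. \<bar>t n\<bar> \<le> R" using convergent_imp_bounded[OF t(2)] by (auto simp: bounded_iff)
  obtain K where K: "\<And>s x. s \<in> {0..R} \<Longrightarrow> norm (T s x) \<le> K * norm x"
    using bicontinuous_semigroup_bounded_on[OF T] by blast
  have tR: "t n \<in> {0..R}" for n using t R[of n] by (auto intro: less_imp_le)
  have "continuous_map (top_of_set {0..}) \<tau> (\<lambda>t. T t z)"
    using T by (simp add: bicontinuous_semigroup_def)
  then have "continuous_map (top_of_set {0..R}) \<tau> (\<lambda>t. T t z)"
    by (rule continuous_map_from_subtopology_mono) auto
  moreover have "bounded ((\<lambda>t. T t z) ` {0..R})" using K by (intro boundedI[of _ "K * norm z"]) auto
  moreover have "0 \<in> {0..R}" using tR[of 0] by auto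
  ultimately have "limitin (mixed_topology \<tau>) (\<lambda>n. T (t n) z) (T 0 z) sequentially"
    using tR t(2) by (intro mixed_limit_of_continuous[OF lct adm, where S = "{0..R}"]) auto
  moreover have "T 0 z = z" using T by (simp add: bicontinuous_semigroup_def semigroup_law_def)
  ultimately show "\<forall>\<^sub>F n in sequentially. T (t n) z - z \<in> C"
    using C unfolding limitin_iff_disc_nhd[OF
      locally_convex_mixed_topology[OF lct bicontinuous_admissibleD(1)[OF adm]]] by simp
qed

lemma C0_semigroup_mixed:
  assumes lct: "locally_convex_topology \<tau>" and haus: "Hausdorff_space \<tau>"
    and adm: "bicontinuous_admissible \<tau>" and T: "bicontinuous_semigroup \<tau> \<alpha> T"
  shows "C0_semigroup_on (mixed_topology \<tau>) T"
  using T locally_convex_mixed_topology[OF lct bicontinuous_admissibleD(1)[OF adm]]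
    Hausdorff_mixed_topology[OF lct bicontinuous_admissibleD(1)[OF adm] haus]
    mixed_strongly_continuous[OF lct adm T]
  by (auto simp: C0_semigroup_on_def bicontinuous_semigroup_def bounded_linear.linear)

lemma C0_semigroup_rescale:
  assumes "C0_semigroup_on Z T"
  shows "C0_semigroup_on Z (\<lambda>t x. exp (- \<nu> * t) *\<^sub>R T t x)"
proof -
  have Z: "locally_convex_topology Z" "Hausdorff_space Z" and lin: "\<And>t. t \<ge> 0 \<Longrightarrow> linear (T t)"
    and T0: "T 0 = id" and add: "\<And>s t. t \<ge> 0 \<Longrightarrow> s \<ge> 0 \<Longrightarrow> T (t + s) = T t \<circ> T s"
    and lim: "\<And>z. limitin Z (\<lambda>t. T t z) z (at_right 0)"
    using assms by (auto simp: C0_semigroup_on_def semigroup_law_def)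
  have "linear (\<lambda>x. exp (- \<nu> * t) *\<^sub>R T t x)" if "t \<ge> 0" for t
    using linear_compose_scale_right[OF lin[OF that]] .
  moreover have "semigroup_law (\<lambda>t x. exp (- \<nu> * t) *\<^sub>R T t x)"
    using T0 add lin
    by (auto simp: semigroup_law_def fun_eq_iff linear_scale exp_add[symmetric] algebra_simps)
  moreover have "limitin Z (\<lambda>t. exp (- \<nu> * t) *\<^sub>R T t z) z (at_right 0)" for z
  proof -
    have "((\<lambda>t. exp (- \<nu> * t)) \<longlongrightarrow> exp (- \<nu> * 0)) (at_right 0)" by (intro tendsto_intros)
    then have "limitin (prod_topology euclideanreal Z) (\<lambda>t. (exp (- \<nu> * t), T t z)) (1, z) (at_right 0)"
      using lim[of z] by (simp add: limitin_pairwise o_def)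
    moreover have "continuous_map (prod_topology euclideanreal Z) Z (\<lambda>(c, x). c *\<^sub>R x)"
      using Z by (simp add: locally_convex_topology_def)
    ultimately show ?thesis using continuous_map_limit by (fastforce simp: o_def)
  qed
  ultimately show ?thesis using Z by (simp add: C0_semigroup_on_def)
qed

text \<open>
  Past some time \<open>R\<close> the rescaled operators are so small in norm that they map the bounded sequence of
  differences into a norm ball inside \<open>C\<close>. On \<open>{0..R}\<close> local equicontinuity applies, with \<open>C\<close> shrunk to
  absorb the factors \<open>exp (- \<nu> * t)\<close>.
\<close>

lemma mixed_rescaled_equicontinuous:
  assumes lct: "locally_convex_topology \<tau>" and adm: "bicontinuous_admissible \<tau>"
    and T: "bicontinuous_semigroup \<tau> \<alpha> T" and \<nu>: "\<nu> > \<alpha>"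
  shows "sequentially_equicontinuous (mixed_topology \<tau>) {0..} (\<lambda>t x. exp (- \<nu> * t) *\<^sub>R T t x)"
proof -
  let ?Z = "mixed_topology \<tau>"
  note co = bicontinuous_admissibleD(1)[OF adm]
  note lctm = locally_convex_mixed_topology[OF lct co]
  obtain M where M: "M \<ge> 0" "\<And>t x. t \<ge> 0 \<Longrightarrow> norm (T t x) \<le> M * exp (\<alpha> * t) * norm x"
    using bicontinuous_semigroup_norm_bound[OF T] by blast
  have lin: "linear (T t)" if "t \<ge> 0" for t
    using T that by (simp add: bicontinuous_semigroup_def bounded_linear.linear)
  show ?thesis unfolding sequentially_equicontinuous_iff_disc_nhd[OF lctm]
  proof (intro allI impI)
    fix zs z C assume z: "limitin ?Z zs z sequentially" and C: "disc_nhd ?Z C"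
    have ac: "abs_convex C" using C by (simp add: disc_nhd_def)
    obtain e where e: "e > 0" "\<And>x. norm x < e \<Longrightarrow> x \<in> C"
      using mixed_discs_contains_ball[OF lct co] C disc_nhd_mixed_iff[OF lct co] by blast
    obtain L where L: "\<And>n. norm (zs n) \<le> L"
      using z limitin_mixed_iff[OF lct adm] by (auto simp: bounded_iff)
    have "((\<lambda>t. exp ((\<alpha> - \<nu>) * t)) \<longlongrightarrow> 0) at_top" using \<nu> by (intro exp_decay_at_top) simp
    then have "((\<lambda>t. exp ((\<alpha> - \<nu>) * t) * (M * (L + norm z))) \<longlongrightarrow> 0) at_top"
      by (rule tendsto_mult_left_zero)
    then have "\<forall>\<^sub>F t in at_top. exp ((\<alpha> - \<nu>) * t) * (M * (L + norm z)) < e"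
      using e(1) by (rule order_tendstoD(2))
    then obtain R0 where R0: "\<And>t. t \<ge> R0 \<Longrightarrow> exp ((\<alpha> - \<nu>) * t) * (M * (L + norm z)) < e"
      by (auto simp: eventually_at_top_linorder)
    define R where "R = max R0 1"
    have R: "R > 0" by (simp add: R_def)
    define E where "E = exp (\<bar>\<nu>\<bar> * R)"
    have "disc_nhd ?Z {x. E *\<^sub>R x \<in> C}" by (rule disc_nhd_scale[OF lctm C])
    then obtain N where N: "\<And>t n. t \<in> {0..R} \<Longrightarrow> n \<ge> N \<Longrightarrow> E *\<^sub>R (T t (zs n) - T t z) \<in> C"
      using mixed_locally_equicontinuous[OF lct adm T R] z
      unfolding sequentially_equicontinuous_iff_disc_nhd[OF lctm] by blast
    have "exp (- \<nu> * t) *\<^sub>R T t (zs n) - exp (- \<nu> * t) *\<^sub>R T t z \<in> C" if t: "t \<ge> 0" and n: "n \<ge> N" for t n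
    proof (cases "t \<le> R")
      case True
      have "- \<nu> * t \<le> \<bar>\<nu>\<bar> * R" using True t by (intro mult_mono) auto
      then have "\<bar>exp (- \<nu> * t) / E\<bar> \<le> 1" by (simp add: E_def)
      from abs_convex_scale[OF ac N[of t n] this]
      show ?thesis using True t n by (simp add: E_def scaleR_diff_right)
    next
      case False
      have "norm (exp (- \<nu> * t) *\<^sub>R T t (zs n - z)) \<le> exp (- \<nu> * t) * (M * exp (\<alpha> * t) * norm (zs n - z))"
        using mult_left_mono[OF M(2)[OF t, of "zs n - z"], of "exp (- \<nu> * t)"] by simp
      also have "\<dots> = exp ((\<alpha> - \<nu>) * t) * (M * norm (zs n - z))"
        by (simp add: exp_diff exp_minus field_simps)
      also have "norm (zs n - z) \<le> L + norm z"
        using norm_triangle_ineq4[of "zs n" z] L[of n] by simp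
      then have "exp ((\<alpha> - \<nu>) * t) * (M * norm (zs n - z)) \<le> exp ((\<alpha> - \<nu>) * t) * (M * (L + norm z))"
        using M(1) by (intro mult_left_mono) auto
      also have "\<dots> < e" using R0[of t] False by (simp add: R_def)
      finally have "exp (- \<nu> * t) *\<^sub>R T t (zs n - z) \<in> C" by (rule e(2))
      then show ?thesis using lin[OF t] by (simp add: linear_diff scaleR_diff_right)
    qed
    then show "\<exists>N. \<forall>t\<in>{0..}. \<forall>n\<ge>N. exp (- \<nu> * t) *\<^sub>R T t (zs n) - exp (- \<nu> * t) *\<^sub>R T t z \<in> C"
      by (intro exI[of _ N]) auto
  qed
qed

lemma mixed_resolvent_integral:
  fixes T :: "real \<Rightarrow> 'a::banach \<Rightarrow> 'a"
  assumes lct: "locally_convex_topology \<tau>" and adm: "bicontinuous_admissible \<tau>"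
    and T: "bicontinuous_semigroup \<tau> \<alpha> T" and \<nu>: "\<nu> > \<alpha>" and \<mu>: "\<mu> > 0"
  shows "generalized_Riemann_integrable_in (mixed_topology \<tau>)
    (\<lambda>t. exp (- \<mu> * t) *\<^sub>R exp (- \<nu> * t) *\<^sub>R T t x)"
proof -
  obtain M where M: "M \<ge> 0" "\<And>t x. t \<ge> 0 \<Longrightarrow> norm (T t x) \<le> M * exp (\<alpha> * t) * norm x"
    using bicontinuous_semigroup_norm_bound[OF T] by blast
  have cexp: "continuous_map (top_of_set {0..}) euclideanreal (\<lambda>t::real. exp (- r * t))" for r
    by (simp add: continuous_map_iff_continuous continuous_intros)
  have orbit: "continuous_map (top_of_set {0..}) \<tau> (\<lambda>t. T t x)"
    using T by (simp add: bicontinuous_semigroup_def)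
  show ?thesis
  proof (rule mixed_generalized_Riemann_integrable[OF lct adm])
    show "continuous_map (top_of_set {0..}) \<tau> (\<lambda>t. exp (- \<mu> * t) *\<^sub>R exp (- \<nu> * t) *\<^sub>R T t x)"
      by (intro lct_continuous_scaleR[OF lct] cexp orbit)
    show "\<mu> + \<nu> - \<alpha> > 0" using \<nu> \<mu> by simp
    fix t :: real assume "t \<ge> 0"
    then have "exp (- \<mu> * t) * (exp (- \<nu> * t) * norm (T t x))
        \<le> exp (- \<mu> * t) * (exp (- \<nu> * t) * (M * exp (\<alpha> * t) * norm x))"
      using M(2) by (intro mult_left_mono) auto
    also have "\<dots> = M * norm x * exp (- (\<mu> + \<nu> - \<alpha>) * t)"
      by (simp add: exp_diff exp_minus exp_add field_simps)
    finally show "norm (exp (- \<mu> * t) *\<^sub>R exp (- \<nu> * t) *\<^sub>R T t x) \<le> M * norm x * exp (- (\<mu> + \<nu> - \<alpha>) * t)"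
      by simp
  qed
qed

theorem proposition3p43:
  fixes \<tau> :: "'a::banach topology"
    and T :: "real \<Rightarrow> 'a \<Rightarrow> 'a"
    and \<alpha> :: real
  assumes "locally_convex_topology \<tau>"
    and "Hausdorff_space \<tau>"
    and "bicontinuous_admissible \<tau>"
    and "bicontinuous_semigroup \<tau> \<alpha> T"
  shows "\<exists>\<tau>' :: 'a topology.
    locally_convex_topology \<tau>' \<and>
    coarser_topology \<tau> \<tau>' \<and> coarser_topology \<tau>' euclidean \<and>
    (\<forall>xs. convergent_seq_in \<tau>' xs \<longleftrightarrow> bounded (range xs) \<and> convergent_seq_in \<tau> xs) \<and>
    sequentially_complete \<tau>' \<and>
    C0_seq_locally_equicontinuous_semigroup \<tau>' T \<and>
    (\<forall>\<nu>>\<alpha>.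
       C0_seq_equicontinuous_semigroup \<tau>' (\<lambda>t x. exp (- \<nu> * t) *\<^sub>R T t x) \<and>
       (\<forall>x. \<forall>\<mu>>0. generalized_Riemann_integrable_in \<tau>'
          (\<lambda>t. exp (- \<mu> * t) *\<^sub>R exp (- \<nu> * t) *\<^sub>R T t x)))"
proof (intro exI[of _ "mixed_topology \<tau>"] conjI allI impI)
  note lct = assms(1) and adm = assms(3) and T = assms(4)
  note co = bicontinuous_admissibleD(1)[OF adm]
  note C0 = C0_semigroup_mixed[OF lct assms(2) adm T]
  show "locally_convex_topology (mixed_topology \<tau>)" by (rule locally_convex_mixed_topology[OF lct co])
  show "coarser_topology \<tau> (mixed_topology \<tau>)" by (rule coarser_mixed_topology[OF lct co])
  show "coarser_topology (mixed_topology \<tau>) euclidean" by (rule mixed_topology_coarser_norm[OF lct co])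
  show "convergent_seq_in (mixed_topology \<tau>) xs \<longleftrightarrow> bounded (range xs) \<and> convergent_seq_in \<tau> xs" for xs
    by (auto simp: convergent_seq_in_def limitin_mixed_iff[OF lct adm])
  show "sequentially_complete (mixed_topology \<tau>)" by (rule sequentially_complete_mixed[OF lct adm])
  show "C0_seq_locally_equicontinuous_semigroup (mixed_topology \<tau>) T"
    using C0 mixed_locally_equicontinuous[OF lct adm T]
    by (simp add: C0_seq_locally_equicontinuous_semigroup_def)
  fix \<nu> assume \<nu>: "\<nu> > \<alpha>"
  show "C0_seq_equicontinuous_semigroup (mixed_topology \<tau>) (\<lambda>t x. exp (- \<nu> * t) *\<^sub>R T t x)"
    using C0_semigroup_rescale[OF C0] mixed_rescaled_equicontinuous[OF lct adm T \<nu>]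
    by (simp add: C0_seq_equicontinuous_semigroup_def)
  show "generalized_Riemann_integrable_in (mixed_topology \<tau>)
      (\<lambda>t. exp (- \<mu> * t) *\<^sub>R exp (- \<nu> * t) *\<^sub>R T t x)" if "\<mu> > 0" for x \<mu>
    by (rule mixed_resolvent_integral[OF lct adm T \<nu> that])
qed

end
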